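(* Let $T$ be an ergodic automorphism of $\mathbb T^2=\mathbb R^2/\mathbb Z^2$ given by $M_T=\begin{pmatrix} a&b\\c&d\end{pmatrix}\in GL(2,\mathbb Z)$ with $r=\operatorname{Tr}M_T>0$, $\sigma=\det M_T$. (1) $T$ admits a bijective arithmetic coding only if $M_T$ is primitive, with the exception of the case $M_T=K^2$, where $K$ is algebraically conjugate to $\begin{pmatrix}1&1\\1&0\end{pmatrix}$. (2) Suppose that one of the equations $f_T(x,y)=\pm1$ is solvable in integers. If $M_T$ is primitive, then there exists a homoclinic point of $T$, with coordinates $(\xi_0,\eta_0)$ in $\mathbb R^2$, such that any bijective arithmetic coding of $T$ is of the form $$\varphi_k^{\pm}(\varepsilon)=\Big(\sum_{n=-\infty}^\infty\varepsilon_n\lambda^{-n}\Big)\begin{pmatrix}\pm\xi_0\lambda^k\\\pm\eta_0\lambda^k\end{pmatrix}\bmod\mathbb Z^2$$ for some $k\in\mathbb Z$ and some choice of sign (the same in both coordinates). If $M_T$ is not primitive, then $\lambda=\frac{3+\sqrt5}2$, and there exists a homoclinic point $(\xi_0,\eta_0)$ such that any bijective arithmetic coding of $T$ is of the form $$\varphi_k^{\pm}(\varepsilon)=\Big(\sum_{n=-\infty}^\infty\varepsilon_n\lambda^{-n}\Big)\begin{pmatrix}\pm\xi_0\theta^k\\\pm\eta_0\theta^k\end{pmatrix}\bmod\mathbb Z^2,\qquad \theta=\sqrt\lambda=\frac{1+\sqrt5}2,$$ for some $k\in\mathbb Z$ and some choice of sign.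
   Context: For $2$-torus automorphisms ergodicity is equivalent to hyperbolicity. Put $D=r^2-4\sigma$, $\lambda=\frac{r+\sqrt D}2>1$. The form associated with $T$ is $f_T(x,y)=bx^2-(a-d)xy-cy^2$. Matrices $M_1,M_2$ are algebraically conjugate if $BM_1B^{-1}=M_2$ for some $B\in GL(2,\mathbb Z)$. A matrix $M\in GL(2,\mathbb Z)$ is primitive if there is no $K\in GL(2,\mathbb Z)$ and $n\ge2$ with $M=K^n$. Homoclinic points: $x\in\mathbb T^2$ is homoclinic (to zero) for $T$ if $T^nx\to0$ as $n\to\pm\infty$. It is written in coordinates of $\mathbb R^2$ as its unique lift $\mathbf t\in\mathbb R^2$ on the $\lambda$-eigenline of $M_T$. Symbolic compactum $\mathfrak X$: if $\sigma=-1$, the set of two-sided sequences with $\varepsilon_n\in\{0,\dots,r\}$ and $\varepsilon_n=r\Rightarrow\varepsilon_{n+1}=0$; if $\sigma=+1$, the set of two-sided sequences with $\varepsilon_n\in\{0,\dots,r-1\}$ containing no block $(r-1)(r-2)^j(r-1)$, $j\ge0$. An arithmetic coding of $T$ is a map $\varphi_{\mathbf t}:\mathfrak X\to\mathbb T^2$, $\varphi_{\mathbf t}(\varepsilon)=\lim_{N\to\infty}\big(\sum_{n=-N}^N\varepsilon_n\lambda^{-n}\big)\mathbf t\bmod\mathbb Z^2$, where $\mathbf t\neq0$ is a homoclinic point of $T$ in coordinates of $\mathbb R^2$ (the limit exists and the map is onto). All two-sided series modulo $\mathbb Z^2$ are understood as such limits. It is bijective if Lebesgue-almost every point of $\mathbb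 T^2$ has exactly one preimage. *)

theory Defs
  imports "HOL-Analysis.Analysis"
begin

quotient_type torus = "real^2" / "\<lambda>x y. \<forall>i. x $ i - y $ i \<in> \<int>"
  morphisms rep_torus to_torus
proof (rule equivpI)
  show "reflp (\<lambda>x y :: real^2. \<forall>i. x $ i - y $ i \<in> \<int>)"
    by (auto simp: reflp_def)
  show "symp (\<lambda>x y :: real^2. \<forall>i. x $ i - y $ i \<in> \<int>)"
    unfolding symp_def
  proof (intro allI impI)
    fix x y :: "real^2" and i
    assume "\<forall>i. x $ i - y $ i \<in> \<int>"
    then have "- (x $ i - y $ i) \<in> \<int>" by (intro Ints_minus) auto
    then show "y $ i - x $ i \<in> \<int>" by simp
  qed
  show "transp (\<lambda>x y :: real^2. \<forall>i. x $ i - y $ i \<in> \<int>)"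
    unfolding transp_def
  proof (intro allI impI)
    fix x y z :: "real^2" and i
    assume "\<forall>i. x $ i - y $ i \<in> \<int>" "\<forall>i. y $ i - z $ i \<in> \<int>"
    then have "(x $ i - y $ i) + (y $ i - z $ i) \<in> \<int>"
      by (intro Ints_add) auto
    then show "x $ i - z $ i \<in> \<int>" by simp
  qed
qed

lemma to_torus_eq_iff: "to_torus x = to_torus y \<longleftrightarrow> (\<forall>i. x $ i - y $ i \<in> \<int>)"
  by (simp add: torus.abs_eq_iff)

lemma to_torus_rep [simp]: "to_torus (rep_torus p) = p"
  by (rule Quotient_abs_rep[OF Quotient_torus])

instantiation torus :: t2_space
begin

definition open_torus :: "torus set \<Rightarrow> bool" where
  "open_torus U \<longleftrightarrow> open (to_torus -` U)"

instance
proof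
  show "open (UNIV :: torus set)" by (simp add: open_torus_def)
  show "open (S \<inter> T)" if "open S" "open T" for S T :: "torus set"
    using that by (simp add: open_torus_def open_Int)
  show "open (\<Union>K)" if "\<forall>S\<in>K. open S" for K :: "torus set set"
    using that by (auto simp: open_torus_def vimage_Union)
  fix p q :: torus
  assume "p \<noteq> q"
  then have "to_torus (rep_torus p) \<noteq> to_torus (rep_torus q)" by simp
  then obtain i where i: "rep_torus p $ i - rep_torus q $ i \<notin> \<int>"
    by (auto simp only: to_torus_eq_iff)
  define g where "g = (\<lambda>x :: real^2. cis (2 * pi * x $ i))"
  have per: "g x = g y" if "to_torus x = to_torus y" for x y
  proof -
    from that have "x $ i - y $ i \<in> \<int>"
      by (simp only: to_torus_eq_iff)
    then obtain k where "x $ i - y $ i = of_int k"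
      by (rule Ints_cases)
    then have "x $ i = y $ i + of_int k" by simp
    then have "2 * pi * x $ i = 2 * pi * y $ i + 2 * pi * of_int k"
      by (simp only: distrib_left)
    then have "g x = g y * cis (2 * pi * of_int k)"
      by (simp only: g_def cis_mult)
    then show ?thesis by simp
  qed
  have "g (rep_torus p) \<noteq> g (rep_torus q)"
  proof
    assume "g (rep_torus p) = g (rep_torus q)"
    then have "sin (2 * pi * rep_torus p $ i) = sin (2 * pi * rep_torus q $ i) \<and>
        cos (2 * pi * rep_torus p $ i) = cos (2 * pi * rep_torus q $ i)"
      by (auto simp: g_def complex_eq_iff)
    then obtain n :: int where
      "2 * pi * rep_torus p $ i = 2 * pi * rep_torus q $ i + 2 * pi * of_int n"
      by (auto simp only: sin_cos_eq_iff)
    then have "2 * pi * rep_torus p $ i = 2 * pi * (rep_torus q $ i + of_int n)"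
      by (simp only: distrib_left)
    then have "rep_torus p $ i - rep_torus q $ i = of_int n" by simp
    with i show False by simp
  qed
  then obtain A B where AB: "open A" "open B" "g (rep_torus p) \<in> A" "g (rep_torus q) \<in> B"
      "A \<inter> B = {}"
    using hausdorff[of "g (rep_torus p)" "g (rep_torus q)"] by auto
  have op: "open {r. g (rep_torus r) \<in> C}" if "open C" for C
  proof -
    have "to_torus -` {r. g (rep_torus r) \<in> C} = g -` C"
      using per[OF to_torus_rep] by auto
    moreover have "open (g -` C)"
      by (rule open_vimage[OF that]) (auto simp: g_def intro!: continuous_intros)
    ultimately show ?thesis by (simp add: open_torus_def)
  qed
  have "open {r. g (rep_torus r) \<in> A}" "open {r. g (rep_torus r) \<in> B}"
    using op AB(1,2) by blast+
  moreover have "p \<in> {r. g (rep_torus r) \<in> A}" "q \<in> {r. g (rep_torus r) \<in> B}"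
    using AB(3,4) by simp_all
  moreover have "{r. g (rep_torus r) \<in> A} \<inter> {r. g (rep_torus r) \<in> B} = {}"
    using AB(5) by blast
  ultimately show "\<exists>U V. open U \<and> open V \<and> p \<in> U \<and> q \<in> V \<and> U \<inter> V = {}"
    by (intro exI conjI)
qed

end

text \<open>Lebesgue measure on the torus, carried over from the fundamental domain \<open>[0,1)\<^sup>2\<close>.\<close>

definition torus_measure :: "torus measure" where
  "torus_measure =
     distr (restrict_space lborel {x :: real^2. \<forall>i. 0 \<le> x $ i \<and> x $ i < 1}) borel to_torus"

definition ergodic :: "'a measure \<Rightarrow> ('a \<Rightarrow> 'a) \<Rightarrow> bool" where
  "ergodic N T \<longleftrightarrow>
     T \<in> measurable N N \<and> distr N N T = N \<and>
     (\<forall>A\<in>sets N. T -` A \<inter> space N = A \<longrightarrow> emeasure N A = 0 \<or> emeasure N (space N - A) = 0)"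

text \<open>\<open>GL(2,\<int>)\<close> is the set of \<open>M :: int^2^2\<close> with \<open>invertible M\<close>: the inverse is required to be
  an integer matrix. The operation \<open>^\<close> on \<open>int^2^2\<close> would be componentwise, hence
  the following definition.\<close>

definition mat_power :: "int^2^2 \<Rightarrow> nat \<Rightarrow> int^2^2" where
  "mat_power M n = ((\<lambda>A. M ** A) ^^ n) (mat 1)"

definition primitive :: "int^2^2 \<Rightarrow> bool" where
  "primitive M \<longleftrightarrow> \<not> (\<exists>K n. invertible K \<and> n \<ge> 2 \<and> M = mat_power K n)"

definition alg_conjugate :: "int^2^2 \<Rightarrow> int^2^2 \<Rightarrow> bool" where
  "alg_conjugate M1 M2 \<longleftrightarrow> (\<exists>B. invertible B \<and> B ** M1 ** matrix_inv B = M2)"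

definition fib_matrix :: "int^2^2" where
  "fib_matrix = vector [vector [1, 1], vector [1, 0]]"

definition quad_form :: "int^2^2 \<Rightarrow> int \<Rightarrow> int \<Rightarrow> int" where
  "quad_form M x y = M$1$2 * x^2 - (M$1$1 - M$2$2) * x * y - M$2$1 * y^2"

definition lead_eigenvalue :: "int^2^2 \<Rightarrow> real" where
  "lead_eigenvalue M =
     (real_of_int (trace M) + sqrt (real_of_int ((trace M)^2 - 4 * det M))) / 2"

lemma map_matrix_diff_in_Ints:
  fixes M :: "int^2^2" and x y :: "real^2"
  assumes "\<forall>i. x $ i - y $ i \<in> \<int>"
  shows "\<forall>i. (map_matrix real_of_int M *v x) $ i - (map_matrix real_of_int M *v y) $ i \<in> \<int>"
proof
  fix i
  have "(\<Sum>j\<in>UNIV. real_of_int (M $ i $ j) * (x $ j - y $ j)) \<in> \<int>"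
    using assms by (intro Ints_sum Ints_mult) auto
  also have "(\<Sum>j\<in>UNIV. real_of_int (M $ i $ j) * (x $ j - y $ j))
      = (map_matrix real_of_int M *v x) $ i - (map_matrix real_of_int M *v y) $ i"
    by (simp only: matrix_vector_mult_def map_matrix_def right_diff_distrib sum_subtractf vec_lambda_beta)
  finally show "(map_matrix real_of_int M *v x) $ i - (map_matrix real_of_int M *v y) $ i \<in> \<int>" .
qed

lift_definition toral_map :: "int^2^2 \<Rightarrow> torus \<Rightarrow> torus" is
  "\<lambda>M x. map_matrix real_of_int M *v x"
  using map_matrix_diff_in_Ints by blast

definition homoclinic :: "(torus \<Rightarrow> torus) \<Rightarrow> torus \<Rightarrow> bool" where
  "homoclinic T p \<longleftrightarrow>
     (\<lambda>n. (T ^^ n) p) \<longlonglongrightarrow> to_torus 0 \<and> (\<lambda>n. (inv T ^^ n) p) \<longlonglongrightarrow> to_torus 0"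

text \<open>A homoclinic point in coordinates of \<open>\<real>\<^sup>2\<close>: its lift on the \<open>\<lambda>\<close>-eigenline. The point
  \<open>t = 0\<close> is included.\<close>

definition homoclinic_coords :: "int^2^2 \<Rightarrow> real^2 \<Rightarrow> bool" where
  "homoclinic_coords M t \<longleftrightarrow>
     homoclinic (toral_map M) (to_torus t) \<and>
     map_matrix real_of_int M *v t = lead_eigenvalue M *\<^sub>R t"

definition compactum :: "int \<Rightarrow> int \<Rightarrow> (int \<Rightarrow> int) set" where
  "compactum r \<sigma> =
     (if \<sigma> = -1 then
        {\<epsilon>. \<forall>n. \<epsilon> n \<in> {0..r} \<and> (\<epsilon> n = r \<longrightarrow> \<epsilon> (n + 1) = 0)}
      else
        {\<epsilon>. (\<forall>n. \<epsilon> n \<in> {0..r - 1}) \<and>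
            \<not> (\<exists>n. \<exists>j :: nat. \<epsilon> n = r - 1 \<and> (\<forall>i\<in>{1..int j}. \<epsilon> (n + i) = r - 2) \<and>
                 \<epsilon> (n + int j + 1) = r - 1)})"

abbreviation coding_space :: "int^2^2 \<Rightarrow> (int \<Rightarrow> int) set" where
  "coding_space M \<equiv> compactum (trace M) (det M)"

text \<open>\<open>is_coding_by M t \<phi>\<close>: on the compactum, \<open>\<phi>\<close> is given by the two-sided series with base
  vector \<open>t\<close>; values of \<open>\<phi>\<close> outside the compactum are irrelevant. Limits in \<open>torus\<close> are unique.\<close>

definition is_coding_by :: "int^2^2 \<Rightarrow> real^2 \<Rightarrow> ((int \<Rightarrow> int) \<Rightarrow> torus) \<Rightarrow> bool" where
  "is_coding_by M t \<phi> \<longleftrightarrow>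
     (\<forall>\<epsilon>\<in>coding_space M.
        (\<lambda>N :: nat. to_torus
           ((\<Sum>n = - int N..int N. real_of_int (\<epsilon> n) * lead_eigenvalue M powi (- n)) *\<^sub>R t))
        \<longlonglongrightarrow> \<phi> \<epsilon>)"

definition arithmetic_coding :: "int^2^2 \<Rightarrow> ((int \<Rightarrow> int) \<Rightarrow> torus) \<Rightarrow> bool" where
  "arithmetic_coding M \<phi> \<longleftrightarrow> (\<exists>t. t \<noteq> 0 \<and> homoclinic_coords M t \<and> is_coding_by M t \<phi>)"

definition bijective_arithmetic_coding :: "int^2^2 \<Rightarrow> ((int \<Rightarrow> int) \<Rightarrow> torus) \<Rightarrow> bool" where
  "bijective_arithmetic_coding M \<phi> \<longleftrightarrow>
     arithmetic_coding M \<phi> \<and>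
     (AE p in torus_measure. \<exists>!\<epsilon>. \<epsilon> \<in> coding_space M \<and> \<phi> \<epsilon> = p)"

end

theory Submission
  imports Defs
begin

text \<open>A homoclinic point is the unstable component \<open>t\<close> of an integer vector \<open>m\<close>. The coding with
  base \<open>t\<close> lifts to the torus \<open>\<real>\<^sup>2/L\<close> with \<open>L = \<int> m + \<int> M m\<close>, and the lift is still onto. Hence if
  \<open>L \<noteq> \<int>\<^sup>2\<close> every point has at least two codes, so a bijective coding forces \<open>det (m, M m) = \<plusminus>1\<close>, that
  is, the form associated with \<open>M\<close> represents \<open>\<plusminus>1\<close> at a cyclic vector. Two cyclic vectors differ by a
  unit of \<open>\<int>[\<lambda>]\<close>. A proper power \<open>M = K\<^sup>n = p + q K\<close> has form divisible by \<open>q\<close>, so \<open>q = \<plusminus>1\<close>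
  and \<open>M\<close>, \<open>K\<close> have equal discriminants, which leaves only \<open>Tr M = 3\<close>, \<open>det M = 1\<close>.\<close>

text \<open>All claims are necessary conditions, so no coding has to be shown bijective; what has to
  be proved is that the lifted coding hits every point. The obstacle is that the digits at negative
  positions carry growing powers of \<open>lam\<close>, so the series diverges in the plane. Modulo
  the lattice, \<open>lam ^ n\<close> times the unstable component equals \<open>- mu ^ n\<close>
  times the stable one, and this contracts. A code thus determines two convergent real sums, hence a
  point of the plane, and these sums are the lift. Greedy expansions have finitely many digits at
  negative positions and reach only nonnegative reals, so surjectivity needs both an approximation
  by conjugates and a compactness argument. The exponents in the conclusion come from the unit
  group: sending \<open>M\<close> to \<open>lam\<close> identifies the ring generated by
  \<open>M\<close> with that generated by \<open>lam\<close>, so primitivity makes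
  \<open>lam\<close> the smallest unit above 1. In the exceptional case that unit is
  \<open>sqrt lam = lam - 1\<close>. Ergodicity enters by excluding traces 1 and 2 for determinant
  1.\<close>

text \<open>By Tychonoff a product of bounded intervals is compact; countability of the index type
  makes it first countable, hence sequentially compact. A convergent sequence of integers is
  eventually constant.\<close>

lemma pointwise_constant_subsequence:
  fixes x :: "nat \<Rightarrow> 'a::countable \<Rightarrow> int"
  assumes "\<And>k a. \<bar>x k a\<bar> \<le> C a"
  obtains f l where "strict_mono (f :: nat \<Rightarrow> nat)" "\<And>a. \<forall>\<^sub>F k in sequentially. x (f k) a = l a"
proof -
  define X where "X = (PiE UNIV (\<lambda>a. {- real_of_int (C a) .. real_of_int (C a)}))"
  have "compactin (product_topology (\<lambda>i. euclidean) UNIV) X"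
    unfolding X_def by (subst compactin_PiE) simp
  then have "compact X"
    by (simp add: euclidean_product_topology)
  then have "seq_compact X"
    by (rule compact_imp_seq_compact)
  moreover have "(\<lambda>a. real_of_int (x k a)) \<in> X" for k
    using assms[of k] unfolding X_def PiE_iff by (auto simp: abs_le_iff minus_le_iff)
      (metis of_int_le_iff of_int_minus)
  ultimately obtain g f where f: "strict_mono f"
    and lim: "((\<lambda>k a. real_of_int (x k a)) \<circ> f) \<longlonglongrightarrow> g"
    unfolding seq_compact_def by metis
  have "\<forall>\<^sub>F k in sequentially. x (f k) a = round (g a)" for a
  proof -
    have "continuous_on UNIV (\<lambda>h :: 'a \<Rightarrow> real. h a)"
      by (rule continuous_on_product_coordinates)
    from continuous_on_tendsto_compose[OF this lim]
    have *: "(\<lambda>k. real_of_int (x (f k) a)) \<longlonglongrightarrow> g a"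
      by (simp add: o_def)
    have "\<forall>\<^sub>F k in sequentially. dist (real_of_int (x (f k) a)) (g a) < 1/4"
      using * by (rule tendstoD) simp
    then obtain N where N: "\<And>k. k \<ge> N \<Longrightarrow> dist (real_of_int (x (f k) a)) (g a) < 1/4"
      unfolding eventually_sequentially by auto
    have "x (f k) a = round (g a)" if "k \<ge> N" for k
      using N[OF that] by (intro round_unique'[symmetric]) (auto simp: dist_real_def abs_minus_commute)
    then show ?thesis
      unfolding eventually_sequentially by blast
  qed
  then show ?thesis
    using that[of f "\<lambda>a. round (g a)"] f by blast
qed

section \<open>Quadratic units\<close>

text \<open>The excluded cases \<open>r = 1\<close> and \<open>r = 2\<close> with
  \<open>\<sigma> = 1\<close> are those in which the roots of \<open>X^2 - r X + \<sigma>\<close>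
  lie on the unit circle.\<close>

locale quadratic_unit =
  fixes r \<sigma> :: int
  assumes sigma: "\<sigma> = 1 \<or> \<sigma> = -1" and r_pos: "r > 0" and r_ge3: "\<sigma> = 1 \<Longrightarrow> r \<ge> 3"
begin

definition lam :: real where "lam = (real_of_int r + sqrt (real_of_int (r\<^sup>2 - 4 * \<sigma>))) / 2"

definition mu :: real where "mu = (real_of_int r - sqrt (real_of_int (r\<^sup>2 - 4 * \<sigma>))) / 2"

lemma disc_pos: "r\<^sup>2 - 4 * \<sigma> > 0"
proof (cases "\<sigma> = 1")
  case True
  then have "r * r \<ge> 3 * 3" using r_ge3 by (intro mult_mono) auto
  then show ?thesis using True by (simp add: power2_eq_square)
next
  case False
  then show ?thesis using sigma by (simp add: add_nonneg_pos)
qed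

lemma disc_pos_real: "real_of_int (r\<^sup>2 - 4 * \<sigma>) > 0"
  using disc_pos by (simp only: of_int_0_less_iff)

text \<open>The discriminant differs from \<open>r^2\<close> by exactly 4. The neighbouring square
  of \<open>r - 1\<close> or \<open>r + 1\<close> is ruled out by parity, and the next one is
  already too far away.\<close>

lemma disc_not_square: "k\<^sup>2 \<noteq> r\<^sup>2 - 4 * \<sigma>"
proof
  assume "k\<^sup>2 = r\<^sup>2 - 4 * \<sigma>"
  then have k: "\<bar>k\<bar> * \<bar>k\<bar> = r * r - 4 * \<sigma>"
    by (simp add: power2_eq_square)
  show False
  proof (cases "\<sigma> = 1")
    case True
    then have r: "r \<ge> 3" using r_ge3 by simp
    have "\<bar>k\<bar> < r"
    proof (rule ccontr)
      assume "\<not> \<bar>k\<bar> < r"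
      then have "r * r \<le> \<bar>k\<bar> * \<bar>k\<bar>" using r by (intro mult_mono) auto
      with k True show False by simp
    qed
    moreover have "\<bar>k\<bar> \<noteq> r - 1"
    proof
      assume "\<bar>k\<bar> = r - 1"
      with k True have "(r - 1) * (r - 1) = r * r - 4" by simp
      then have "2 * r = 5" by (simp add: algebra_simps)
      then show False by presburger
    qed
    ultimately have "\<bar>k\<bar> \<le> r - 2" by simp
    then have "\<bar>k\<bar> * \<bar>k\<bar> \<le> (r - 2) * (r - 2)" by (intro mult_mono) auto
    with k True r show False by (simp add: algebra_simps)
  next
    case False
    then have s: "\<sigma> = -1" using sigma by simp
    have "r < \<bar>k\<bar>"
    proof (rule ccontr)
      assume "\<not> r < \<bar>k\<bar>"
      then have "\<bar>k\<bar> * \<bar>k\<bar> \<le> r * r" using r_pos by (intro mult_mono) auto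
      with k s show False by simp
    qed
    moreover have "\<bar>k\<bar> \<noteq> r + 1"
    proof
      assume "\<bar>k\<bar> = r + 1"
      with k s have "(r + 1) * (r + 1) = r * r + 4" by simp
      then have "2 * r = 3" by (simp add: algebra_simps)
      then show False by presburger
    qed
    ultimately have "r + 2 \<le> \<bar>k\<bar>" by simp
    then have "(r + 2) * (r + 2) \<le> \<bar>k\<bar> * \<bar>k\<bar>" using r_pos by (intro mult_mono) auto
    with k s r_pos show False by (simp add: algebra_simps)
  qed
qed

lemma lam_plus_mu: "lam + mu = real_of_int r"
  by (simp add: lam_def mu_def field_simps)

lemma lam_times_mu: "lam * mu = real_of_int \<sigma>"
proof -
  have "sqrt (real_of_int (r\<^sup>2 - 4 * \<sigma>)) * sqrt (real_of_int (r\<^sup>2 - 4 * \<sigma>)) = real_of_int (r\<^sup>2 - 4 * \<sigma>)"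
    using disc_pos_real by (subst real_sqrt_mult_self) linarith
  then show ?thesis
    by (simp add: lam_def mu_def field_simps power2_eq_square)
qed

lemma lam_square: "lam * lam = real_of_int r * lam - real_of_int \<sigma>"
proof -
  have "lam * (lam + mu) = lam * real_of_int r" by (simp add: lam_plus_mu)
  then show ?thesis by (simp add: distrib_left lam_times_mu mult.commute)
qed

lemma mu_square: "mu * mu = real_of_int r * mu - real_of_int \<sigma>"
proof -
  have "mu * (lam + mu) = mu * real_of_int r" by (simp add: lam_plus_mu)
  then show ?thesis using lam_times_mu by (simp add: distrib_left mult.commute)
qed

lemma mu_less_lam: "mu < lam"
proof -
  have "sqrt (real_of_int (r\<^sup>2 - 4 * \<sigma>)) > 0" using disc_pos_real by (simp only: real_sqrt_gt_0_iff)
  moreover have "(x - y) / 2 < (x + y) / 2" if "y > 0" for x y :: real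
    using that by (simp add: field_simps)
  ultimately show ?thesis unfolding lam_def mu_def by blast
qed

lemma lam_gt_1: "lam > 1"
proof (cases "\<sigma> = 1")
  case True
  then have "real_of_int r \<ge> 3" using r_ge3 by simp
  moreover have "sqrt (real_of_int (r\<^sup>2 - 4 * \<sigma>)) > 0" using disc_pos_real by (simp only: real_sqrt_gt_0_iff)
  moreover have "1 < (x + y) / 2" if "x \<ge> 3" "y > 0" for x y :: real
    using that by (simp add: field_simps)
  ultimately show ?thesis unfolding lam_def by blast
next
  case False
  then have "real_of_int (r\<^sup>2 - 4 * \<sigma>) > real_of_int (r\<^sup>2)" using sigma by simp
  then have "sqrt (real_of_int (r\<^sup>2 - 4 * \<sigma>)) > sqrt ((real_of_int r)\<^sup>2)"
    by (subst real_sqrt_less_iff) simp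
  moreover have "real_of_int r \<ge> 1" using r_pos by linarith
  ultimately show ?thesis using r_pos unfolding lam_def by simp
qed

lemma abs_mu: "\<bar>mu\<bar> = 1 / lam"
proof -
  have "\<bar>lam * mu\<bar> = 1" using sigma lam_times_mu by auto
  then show ?thesis using lam_gt_1 by (simp add: abs_mult field_simps)
qed

lemma abs_mu_less_1: "\<bar>mu\<bar> < 1"
  using abs_mu lam_gt_1 by simp

lemma mu_nonzero: "mu \<noteq> 0"
  using abs_mu lam_gt_1 by auto

text \<open>Isolating the square root and squaring shows that \<open>j^2\<close> times the
  discriminant is a square. For nonzero \<open>j\<close>, cancelling \<open>j^2\<close> would make
  the discriminant itself a square.\<close>

lemma lam_irrational:
  assumes "real_of_int i + real_of_int j * lam = 0"
  shows "i = 0 \<and> j = 0"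
proof -
  let ?D = "r\<^sup>2 - 4 * \<sigma>"
  have "real_of_int j * sqrt (real_of_int ?D) = - real_of_int (2 * i + j * r)"
    using assms by (simp add: lam_def field_simps)
  then have "(real_of_int j * sqrt (real_of_int ?D))\<^sup>2 = (real_of_int (2 * i + j * r))\<^sup>2"
    by (metis power2_minus)
  moreover have "(sqrt (real_of_int ?D))\<^sup>2 = real_of_int ?D"
    using disc_pos by (intro real_sqrt_pow2) linarith
  ultimately have "real_of_int (j\<^sup>2 * ?D) = real_of_int ((2 * i + j * r)\<^sup>2)"
    by (simp add: power_mult_distrib)
  then have eq: "j\<^sup>2 * ?D = (2 * i + j * r)\<^sup>2"
    by (simp only: of_int_eq_iff)
  then have "j\<^sup>2 dvd (2 * i + j * r)\<^sup>2"
    by (metis dvd_triv_left)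
  then have "j dvd 2 * i + j * r"
    by simp
  then obtain k where k: "2 * i + j * r = j * k" by (elim dvdE)
  have "j = 0"
  proof (rule ccontr)
    assume "j \<noteq> 0"
    with eq k have "?D = k\<^sup>2" by (simp add: power_mult_distrib)
    then show False using disc_not_square by metis
  qed
  with assms show ?thesis by simp
qed

lemma lam_coords_unique:
  assumes "real_of_int i + real_of_int j * lam = real_of_int k + real_of_int l * lam"
  shows "i = k \<and> j = l"
  using lam_irrational[of "i - k" "j - l"] assms by (simp add: algebra_simps)

text \<open>\<open>\<int>[\<lambda>]\<close>, each element paired with its algebraic conjugate.\<close>

definition conj_pairs :: "(real \<times> real) set" where
  "conj_pairs = {(real_of_int i + real_of_int j * lam, real_of_int i + real_of_int j * mu) | i j. True}"

lemma conj_pairsI: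
  "a = real_of_int i + real_of_int j * lam \<Longrightarrow> b = real_of_int i + real_of_int j * mu \<Longrightarrow> (a, b) \<in> conj_pairs"
  unfolding conj_pairs_def by blast

lemma conj_pairsE:
  assumes "(a, b) \<in> conj_pairs"
  obtains i j where "a = real_of_int i + real_of_int j * lam" "b = real_of_int i + real_of_int j * mu"
  using assms unfolding conj_pairs_def by blast

lemma conj_pairs_int: "(real_of_int i, real_of_int i) \<in> conj_pairs"
  by (rule conj_pairsI[of _ i 0]) auto

lemma conj_pairs_1: "(1, 1) \<in> conj_pairs"
  using conj_pairs_int[of 1] by simp

lemma conj_pairs_lam: "(lam, mu) \<in> conj_pairs"
  by (rule conj_pairsI[of _ 0 1]) auto

lemma conj_pairs_add:
  assumes "(a, b) \<in> conj_pairs" "(c, d) \<in> conj_pairs"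
  shows "(a + c, b + d) \<in> conj_pairs"
proof -
  obtain i j where 1: "a = real_of_int i + real_of_int j * lam" "b = real_of_int i + real_of_int j * mu"
    using assms(1) by (rule conj_pairsE)
  obtain k l where 2: "c = real_of_int k + real_of_int l * lam" "d = real_of_int k + real_of_int l * mu"
    using assms(2) by (rule conj_pairsE)
  show ?thesis
    by (rule conj_pairsI[of _ "i + k" "j + l"]) (simp_all add: 1 2 algebra_simps)
qed

lemma conj_pairs_mult:
  assumes "(a, b) \<in> conj_pairs" "(c, d) \<in> conj_pairs"
  shows "(a * c, b * d) \<in> conj_pairs"
proof -
  obtain i j where 1: "a = real_of_int i + real_of_int j * lam" "b = real_of_int i + real_of_int j * mu"
    using assms(1) by (rule conj_pairsE)
  obtain k l where 2: "c = real_of_int k + real_of_int l * lam" "d = real_of_int k + real_of_int l * mu"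
    using assms(2) by (rule conj_pairsE)
  have *: "(real_of_int i + real_of_int j * x) * (real_of_int k + real_of_int l * x)
      = real_of_int (i * k - j * l * \<sigma>) + real_of_int (i * l + j * k + j * l * r) * x"
    if "x * x = real_of_int r * x - real_of_int \<sigma>" for x
  proof -
    have "(real_of_int i + real_of_int j * x) * (real_of_int k + real_of_int l * x)
      = real_of_int (i * k) + real_of_int (i * l + j * k) * x + real_of_int (j * l) * (x * x)"
      by (simp add: algebra_simps)
    then show ?thesis by (simp add: that algebra_simps)
  qed
  show ?thesis
    unfolding 1 2 using *[OF lam_square] *[OF mu_square] by (rule conj_pairsI)
qed

lemma conj_pairs_uminus: "(a, b) \<in> conj_pairs \<Longrightarrow> (- a, - b) \<in> conj_pairs"
  using conj_pairs_mult[OF conj_pairs_int[of "-1"]] by fastforce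

lemma conj_pairs_power: "(a, b) \<in> conj_pairs \<Longrightarrow> (a ^ n, b ^ n) \<in> conj_pairs"
  by (induction n) (auto simp: conj_pairs_1 conj_pairs_mult)

lemma conj_pairs_swap:
  assumes "(a, b) \<in> conj_pairs" shows "(b, a) \<in> conj_pairs"
proof -
  obtain i j where 1: "a = real_of_int i + real_of_int j * lam" "b = real_of_int i + real_of_int j * mu"
    using assms by (rule conj_pairsE)
  have m: "mu = real_of_int r - lam" using lam_plus_mu by simp
  show ?thesis
    by (rule conj_pairsI[of _ "i + j * r" "- j"]) (simp_all add: 1 m algebra_simps)
qed

lemma conj_pairs_digit_sum:
  "((\<Sum>n<K. real_of_int (d n) * lam ^ (n + 1)), (\<Sum>n<K. real_of_int (d n) * mu ^ (n + 1))) \<in> conj_pairs"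
proof (induction K)
  case 0
  then show ?case using conj_pairs_int[of 0] by simp
next
  case (Suc K)
  show ?case
    unfolding sum.lessThan_Suc
    by (intro conj_pairs_add Suc.IH conj_pairs_mult conj_pairs_int conj_pairs_power conj_pairs_lam)
qed

section \<open>Approximating a real by conjugates of very negative elements of the ring\<close>

text \<open>Even exponents are used because \<open>mu\<close> is negative when
  \<open>\<sigma> = -1\<close>, and the next lemma needs multipliers that keep signs.\<close>

lemma mu_even_power_small:
  assumes "e > 0"
  obtains q where "mu ^ (2 * q) < e" "lam ^ (2 * q) \<ge> B"
proof -
  have "(\<lambda>q. (mu\<^sup>2) ^ q) \<longlonglongrightarrow> 0"
    using abs_mu_less_1 by (intro LIMSEQ_power_zero) (auto simp: abs_square_less_1)
  then have 1: "\<forall>\<^sub>F q in sequentially. mu ^ (2 * q) < e"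
    using assms by (auto simp: power_mult dest: order_tendstoD(2))
  obtain N where N: "B < lam ^ N"
    using real_arch_pow[OF lam_gt_1] by blast
  have "B \<le> lam ^ (2 * q)" if "q \<ge> N" for q
  proof -
    have "lam ^ N \<le> lam ^ (2 * q)" using that lam_gt_1 by (intro power_increasing) auto
    then show ?thesis using N by simp
  qed
  then have 2: "\<forall>\<^sub>F q in sequentially. B \<le> lam ^ (2 * q)"
    unfolding eventually_sequentially by blast
  show thesis
    using eventually_happens[OF eventually_conj[OF 1 2]] that by auto
qed

text \<open>Multiplying \<open>(p, q)\<close> by a high even power of \<open>(lam, mu)\<close> gives
  an element as large as desired whose conjugate is a step shorter than \<open>e\<close>. Its
  multiple by \<open>- j\<close> brings the conjugate within one step of \<open>v\<close>. Since
  \<open>v / q \<le> 0\<close>, the required \<open>j\<close> is positive, so the element itself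
  becomes very negative.\<close>

lemma conj_approx_step:
  assumes pq: "(p, q) \<in> conj_pairs" and p: "p > 0" and q: "q \<noteq> 0" and v: "v / q \<le> 0" and e: "e > 0"
  obtains a b where "(a, b) \<in> conj_pairs" "a \<le> u" "\<bar>b - v\<bar> < e"
proof -
  obtain k where k: "mu ^ (2 * k) < e / \<bar>q\<bar>" "lam ^ (2 * k) \<ge> - u / p"
    using mu_even_power_small[of "e / \<bar>q\<bar>" "- u / p"] q e by auto
  define h where "h = mu ^ (2 * k)"
  define H where "H = lam ^ (2 * k)"
  have h: "h > 0" using mu_nonzero by (simp add: h_def power_mult)
  have H: "H > 0" using lam_gt_1 by (simp add: H_def)
  \<comment> \<open>The summand 1 guarantees \<open>j \<ge> 1\<close> even for \<open>v = 0\<close>,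
    at the cost of at most one step of error.\<close>
  define j where "j = \<lfloor>- (v / q) / h\<rfloor> + 1"
  have j1: "j \<ge> 1"
    using divide_nonpos_pos[OF v h] by (simp add: j_def)
  have jb: "\<bar>real_of_int j + v / q / h\<bar> \<le> 1"
    unfolding j_def by linarith
  show thesis
  proof (rule that)
    show "(- (real_of_int j * (p * H)), - (real_of_int j * (q * h))) \<in> conj_pairs"
      unfolding h_def H_def
      by (intro conj_pairs_uminus conj_pairs_mult conj_pairs_int pq conj_pairs_power conj_pairs_lam)
    have "- u \<le> p * H" using k(2) p by (simp add: H_def field_simps)
    also have "p * H \<le> real_of_int j * (p * H)" using j1 p H by simp
    finally show "- (real_of_int j * (p * H)) \<le> u" by simp
    have "- (real_of_int j * (q * h)) - v = - (q * h) * (real_of_int j + v / q / h)"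
      using q h by (simp add: field_simps)
    then have "\<bar>- (real_of_int j * (q * h)) - v\<bar> = \<bar>q\<bar> * h * \<bar>real_of_int j + v / q / h\<bar>"
      using h by (simp add: abs_mult)
    also have "\<dots> \<le> \<bar>q\<bar> * h * 1" using jb h by (intro mult_left_mono) auto
    also have "\<dots> < e" using k(1) q by (simp add: h_def field_simps)
    finally show "\<bar>- (real_of_int j * (q * h)) - v\<bar> < e" .
  qed
qed

text \<open>Two seeds suffice, \<open>(1, 1)\<close> for \<open>v \<le> 0\<close> and
  \<open>(lam - 1, mu - 1)\<close> for \<open>v > 0\<close>: both have a positive first entry, and
  their conjugates have opposite signs. The bound \<open>a \<le> u\<close> makes
  \<open>u - a\<close> accessible to a greedy expansion.\<close>

lemma conj_approx:
  assumes "e > 0"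
  obtains a b where "(a, b) \<in> conj_pairs" "a \<le> u" "\<bar>b - v\<bar> < e"
proof (cases "v \<le> 0")
  case True
  then show thesis
    using conj_approx_step[OF conj_pairs_1, of v e u] assms that by auto
next
  case False
  have "(lam - 1, mu - 1) \<in> conj_pairs"
    using conj_pairs_add[OF conj_pairs_lam conj_pairs_int[of "-1"]] by simp
  moreover have "mu - 1 < 0" using abs_mu_less_1 by linarith
  moreover from this have "v / (mu - 1) \<le> 0" using False by (simp add: divide_nonneg_neg)
  ultimately show thesis
    using conj_approx_step[of "lam - 1" "mu - 1" v e u] lam_gt_1 assms that by auto
qed

text \<open>Subtracting the two values leaves \<open>j * (lam - mu)\<close>, which bounds
  \<open>j\<close> and then \<open>i\<close>. Hence a bounded region contains only finitely many
  elements given with their conjugates.\<close>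

lemma conj_pair_coords_bound:
  assumes "\<bar>real_of_int i + real_of_int j * lam - u\<bar> \<le> C" "\<bar>real_of_int i + real_of_int j * mu - v\<bar> \<le> C"
  shows "\<bar>real_of_int j\<bar> \<le> (2 * C + \<bar>u\<bar> + \<bar>v\<bar>) / (lam - mu)"
    and "\<bar>real_of_int i\<bar> \<le> C + \<bar>v\<bar> + (2 * C + \<bar>u\<bar> + \<bar>v\<bar>) / (lam - mu)"
proof -
  have "\<bar>real_of_int j\<bar> * (lam - mu) = \<bar>real_of_int j * (lam - mu)\<bar>"
    using mu_less_lam by (simp add: abs_mult)
  also have "real_of_int j * (lam - mu) = (real_of_int i + real_of_int j * lam - u)
      - (real_of_int i + real_of_int j * mu - v) + u - v"
    by (simp add: algebra_simps)
  also have "\<bar>\<dots>\<bar> \<le> 2 * C + \<bar>u\<bar> + \<bar>v\<bar>"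
    using assms by linarith
  finally show *: "\<bar>real_of_int j\<bar> \<le> (2 * C + \<bar>u\<bar> + \<bar>v\<bar>) / (lam - mu)"
    using mu_less_lam by (simp add: field_simps)
  have "\<bar>real_of_int j * mu\<bar> \<le> \<bar>real_of_int j\<bar>"
    using abs_mu_less_1 by (simp add: abs_mult mult_left_le)
  then show "\<bar>real_of_int i\<bar> \<le> C + \<bar>v\<bar> + (2 * C + \<bar>u\<bar> + \<bar>v\<bar>) / (lam - mu)"
    using * assms(2) by linarith
qed

subsection \<open>Greedy expansions\<close>

text \<open>This is the orbit of \<open>x\<close> under the beta-transformation with base
  \<open>lam\<close>; its digits satisfy the rules of \<open>compactum\<close>.\<close>

primrec greedy_rem :: "real \<Rightarrow> nat \<Rightarrow> real" where
  "greedy_rem x 0 = x"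
| "greedy_rem x (Suc n) = frac (lam * greedy_rem x n)"

definition greedy_digit :: "real \<Rightarrow> nat \<Rightarrow> int" where
  "greedy_digit x n = \<lfloor>lam * greedy_rem x n\<rfloor>"

lemma greedy_rem_Suc: "greedy_rem x (Suc n) = lam * greedy_rem x n - real_of_int (greedy_digit x n)"
  by (simp add: greedy_digit_def frac_def)

lemma greedy_rem_range:
  assumes "0 \<le> x" "x < 1"
  shows "0 \<le> greedy_rem x n" "greedy_rem x n < 1"
  using assms by (cases n; simp add: frac_lt_1)+

lemma greedy_partial_sum:
  "x = (\<Sum>k<n. real_of_int (greedy_digit x k) / lam ^ (k + 1)) + greedy_rem x n / lam ^ n"
proof (induction n)
  case (Suc n)
  have "greedy_rem x n / lam ^ n
      = real_of_int (greedy_digit x n) / lam ^ (n + 1) + greedy_rem x (Suc n) / lam ^ Suc n"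
    unfolding greedy_rem_Suc using lam_gt_1 by (simp add: field_simps)
  with Suc show ?case unfolding sum.lessThan_Suc by linarith
qed simp

lemma greedy_sums:
  assumes "0 \<le> x" "x < 1"
  shows "(\<lambda>k. real_of_int (greedy_digit x k) / lam ^ (k + 1)) sums x"
proof -
  have "(\<lambda>n. (1 / lam) ^ n) \<longlonglongrightarrow> 0"
    using lam_gt_1 by (intro LIMSEQ_power_zero) simp
  then have "(\<lambda>n. greedy_rem x n / lam ^ n) \<longlonglongrightarrow> 0"
  proof (rule tendsto_sandwich[OF _ _ tendsto_const, rotated 2])
    show "\<forall>\<^sub>F n in sequentially. 0 \<le> greedy_rem x n / lam ^ n"
      using greedy_rem_range[OF assms] lam_gt_1 by (intro always_eventually) auto
    show "\<forall>\<^sub>F n in sequentially. greedy_rem x n / lam ^ n \<le> (1 / lam) ^ n"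
      using greedy_rem_range(2)[OF assms, THEN less_imp_le] lam_gt_1
      by (intro always_eventually) (auto simp: power_one_over divide_simps)
  qed
  then have "(\<lambda>n. x - greedy_rem x n / lam ^ n) \<longlonglongrightarrow> x - 0"
    by (intro tendsto_intros)
  moreover have "(\<Sum>k<n. real_of_int (greedy_digit x k) / lam ^ (k + 1)) = x - greedy_rem x n / lam ^ n" for n
    using greedy_partial_sum[of x n] by linarith
  ultimately show ?thesis unfolding sums_def by simp
qed

lemma lam_eq: "lam = real_of_int r - real_of_int \<sigma> / lam"
proof -
  have "mu = real_of_int \<sigma> / lam" using lam_times_mu lam_gt_1 by (simp add: field_simps)
  then show ?thesis using lam_plus_mu by linarith
qed

lemma greedy_digit_nonneg:
  assumes "0 \<le> x" "x < 1" shows "0 \<le> greedy_digit x n"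
  using greedy_rem_range[OF assms, of n] lam_gt_1 by (simp add: greedy_digit_def)

lemma greedy_digit_less:
  assumes "0 \<le> x" "x < 1" shows "real_of_int (greedy_digit x n) < lam"
proof -
  have "real_of_int (greedy_digit x n) \<le> lam * greedy_rem x n" by (simp add: greedy_digit_def)
  also have "\<dots> < lam" using greedy_rem_range[OF assms, of n] lam_gt_1 by simp
  finally show ?thesis .
qed

text \<open>Here \<open>lam = r + 1 / lam\<close>. A digit \<open>r\<close> leaves a remainder below
  \<open>1 / lam\<close>, and multiplying this by \<open>lam\<close> does not reach 1.\<close>

lemma greedy_digit_minus:
  assumes "0 \<le> x" "x < 1" "\<sigma> = -1"
  shows "greedy_digit x n \<le> r" and "greedy_digit x n = r \<Longrightarrow> greedy_digit x (Suc n) = 0"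
proof -
  have l: "lam = real_of_int r + 1 / lam" using lam_eq assms(3) by simp
  moreover have "1 / lam < 1" using lam_gt_1 by simp
  ultimately have "real_of_int (greedy_digit x n) < real_of_int (r + 1)"
    using greedy_digit_less[OF assms(1,2), of n] by (simp only: of_int_add of_int_1)
  then show "greedy_digit x n \<le> r" by (simp only: of_int_less_iff)
  assume "greedy_digit x n = r"
  then have "greedy_rem x (Suc n) = lam * greedy_rem x n - r" by (simp only: greedy_rem_Suc)
  also have "\<dots> < lam - r" using greedy_rem_range[OF assms(1,2), of n] lam_gt_1 by simp
  also have "\<dots> = 1 / lam" using l by linarith
  finally have "lam * greedy_rem x (Suc n) < 1" using lam_gt_1 by (simp add: field_simps)
  moreover have "0 \<le> lam * greedy_rem x (Suc n)"
    using greedy_rem_range(1)[OF assms(1,2), of "Suc n"] lam_gt_1 by simp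
  ultimately show "greedy_digit x (Suc n) = 0"
    unfolding greedy_digit_def by (simp only: floor_eq_iff) simp
qed

text \<open>Here \<open>lam = r - 1 / lam\<close>. After a digit \<open>r - 1\<close> the remainder
  is below \<open>1 - 1 / lam\<close>, which is the fixed point of the map \<open>y\<close> to
  \<open>lam * y - (r - 2)\<close>. So digits \<open>r - 2\<close> keep the remainder below it, and
  there the digit \<open>r - 1\<close> is out of reach because
  \<open>lam - 1 < r - 1\<close>.\<close>

lemma greedy_digit_plus:
  assumes "0 \<le> x" "x < 1" "\<sigma> = 1"
  shows "greedy_digit x n \<le> r - 1"
    and "greedy_digit x n = r - 1 \<Longrightarrow> (\<And>i. i \<in> {1..j} \<Longrightarrow> greedy_digit x (n + i) = r - 2)
      \<Longrightarrow> greedy_digit x (n + j + 1) \<noteq> r - 1"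
proof -
  have l: "lam = real_of_int r - 1 / lam" using lam_eq assms(3) by simp
  have l1: "0 < 1 / lam" "1 / lam < 1" using lam_gt_1 by simp_all
  have "real_of_int (greedy_digit x n) < real_of_int r"
    using greedy_digit_less[OF assms(1,2), of n] l l1 by linarith
  then show "greedy_digit x n \<le> r - 1" by simp
  assume n: "greedy_digit x n = r - 1" and i: "\<And>i. i \<in> {1..j} \<Longrightarrow> greedy_digit x (n + i) = r - 2"
  have "greedy_rem x (n + k + 1) < 1 - 1 / lam" if "k \<le> j" for k
    using that
  proof (induction k)
    case 0
    have "greedy_rem x (Suc n) = lam * greedy_rem x n - real_of_int (r - 1)"
      by (simp only: greedy_rem_Suc n)
    also have "\<dots> < lam - real_of_int (r - 1)"
      using greedy_rem_range[OF assms(1,2), of n] lam_gt_1 by simp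
    also have "\<dots> = 1 - 1 / lam" using l by simp
    finally show ?case by simp
  next
    case (Suc k)
    have "greedy_digit x (n + k + 1) = r - 2" using i[of "Suc k"] Suc.prems by simp
    then have "greedy_rem x (Suc (n + k + 1)) = lam * greedy_rem x (n + k + 1) - real_of_int (r - 2)"
      by (simp only: greedy_rem_Suc)
    also have "lam * greedy_rem x (n + k + 1) < lam * (1 - 1 / lam)"
      using Suc lam_gt_1 by (intro mult_strict_left_mono) auto
    also have "lam * (1 - 1 / lam) - real_of_int (r - 2) = 1 - 1 / lam"
      using l lam_gt_1 by (simp add: right_diff_distrib)
    finally show ?case by simp
  qed
  from this[of j] have "lam * greedy_rem x (n + j + 1) < lam * (1 - 1 / lam)"
    using lam_gt_1 by (intro mult_strict_left_mono) auto
  also have "\<dots> = lam - 1"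
    using lam_gt_1 by (simp add: right_diff_distrib)
  also have "\<dots> < real_of_int (r - 1)"
    using l l1 unfolding of_int_diff of_int_1 by linarith
  finally have "greedy_digit x (n + j + 1) < r - 1"
    unfolding greedy_digit_def by (simp only: floor_less_iff)
  then show "greedy_digit x (n + j + 1) \<noteq> r - 1" by simp
qed

text \<open>Zeros on the left create no forbidden block: such a block starts with the positive digit
  \<open>r\<close> or \<open>r - 1\<close>, hence lies inside the greedy expansion.\<close>

lemma shifted_greedy_in_compactum:
  fixes K :: nat
  assumes x: "0 \<le> x" "x < 1"
  defines "\<epsilon> \<equiv> \<lambda>n. if n \<ge> - int K then greedy_digit x (nat (n + int K)) else 0"
  shows "\<epsilon> \<in> compactum r \<sigma>"
proof (cases "\<sigma> = -1")
  case True
  have "\<epsilon> n \<in> {0..r}" for n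
    using greedy_digit_nonneg[OF x] greedy_digit_minus(1)[OF x True] r_pos by (auto simp: \<epsilon>_def)
  moreover have "\<epsilon> (n + 1) = 0" if "\<epsilon> n = r" for n
  proof -
    have n: "n \<ge> - int K" "greedy_digit x (nat (n + int K)) = r"
      using that r_pos by (auto simp: \<epsilon>_def split: if_splits)
    have "nat (n + 1 + int K) = Suc (nat (n + int K))" using n(1) by linarith
    then show ?thesis using n greedy_digit_minus(2)[OF x True n(2)] by (simp add: \<epsilon>_def)
  qed
  ultimately show ?thesis using True by (simp add: compactum_def)
next
  case False
  then have s: "\<sigma> = 1" using sigma by simp
  then have r: "r \<ge> 3" using r_ge3 by simp
  have "\<epsilon> n \<in> {0..r - 1}" for n
    using greedy_digit_nonneg[OF x] greedy_digit_plus(1)[OF x s] r by (auto simp: \<epsilon>_def)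
  moreover have "\<epsilon> (n + int j + 1) \<noteq> r - 1"
    if "\<epsilon> n = r - 1" "\<forall>i\<in>{1..int j}. \<epsilon> (n + i) = r - 2" for n j
  proof -
    have n: "n \<ge> - int K" "greedy_digit x (nat (n + int K)) = r - 1"
      using that(1) r by (auto simp: \<epsilon>_def split: if_splits)
    have e: "\<epsilon> (n + int i) = greedy_digit x (nat (n + int K) + i)" for i
    proof -
      have "nat (n + int i + int K) = nat (n + int K) + i" using n(1) by linarith
      then show ?thesis using n(1) by (simp add: \<epsilon>_def)
    qed
    have "greedy_digit x (nat (n + int K) + i) = r - 2" if "i \<in> {1..j}" for i
      using that \<open>\<forall>i\<in>{1..int j}. \<epsilon> (n + i) = r - 2\<close>[rule_format, of "int i"] by (simp add: e)
    from greedy_digit_plus(2)[OF x s n(2) this] show ?thesis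
      using e[of "j + 1"] by (simp add: algebra_simps)
  qed
  ultimately show ?thesis using s unfolding compactum_def by auto
qed

text \<open>The finitely many digits at negative positions are split off because their sum lies in
  the ring generated by \<open>lam\<close>, so it can be absorbed into the lattice part and replaced
  by its conjugate.\<close>

lemma greedy_expansion:
  assumes "x \<ge> 0"
  obtains \<epsilon> K where "\<epsilon> \<in> compactum r \<sigma>" "\<And>n. n \<ge> K \<Longrightarrow> \<epsilon> (- 1 - int n) = 0"
    "(\<lambda>n. real_of_int (\<epsilon> (int n)) / lam ^ n) sums (x - (\<Sum>n<K. real_of_int (\<epsilon> (- 1 - int n)) * lam ^ (n + 1)))"
proof -
  obtain K where "x < lam ^ K" using real_arch_pow[OF lam_gt_1] by blast
  then have K: "x < lam ^ (K + 1)"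
    using lam_gt_1 power_strict_increasing[of K "K + 1" lam] by linarith
  \<comment> \<open>The digit \<open>greedy_digit y k\<close> has weight
    \<open>lam ^ (- k - 1)\<close>; rescaling by \<open>lam ^ (K + 1)\<close> moves it to position
    \<open>k - K\<close>, which is the shift by \<open>K\<close> in
    \<open>\<epsilon>\<close>.\<close>
  define y where "y = x / lam ^ (K + 1)"
  have lp: "lam ^ n > 0" for n using lam_gt_1 by simp
  have y: "0 \<le> y" "y < 1" using assms K lp[of "K + 1"] by (simp_all add: y_def field_simps)
  define \<epsilon> where "\<epsilon> = (\<lambda>n. if n \<ge> - int K then greedy_digit y (nat (n + int K)) else 0)"
  have 1: "\<epsilon> \<in> compactum r \<sigma>"
    unfolding \<epsilon>_def by (rule shifted_greedy_in_compactum[OF y])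
  have 2: "\<epsilon> (- 1 - int n) = 0" if "n \<ge> K" for n using that by (simp add: \<epsilon>_def)
  define f where "f = (\<lambda>k. lam ^ (K + 1) * (real_of_int (greedy_digit y k) / lam ^ (k + 1)))"
  have "f sums (lam ^ (K + 1) * y)"
    unfolding f_def by (intro sums_mult greedy_sums y)
  then have "f sums x" using lp[of "K + 1"] lam_gt_1 by (simp add: y_def)
  then have "(\<lambda>n. f (n + K)) sums (x - (\<Sum>i<K. f i))"
    by (rule sums_split_initial_segment)
  moreover have "f (n + K) = real_of_int (\<epsilon> (int n)) / lam ^ n" for n
  proof -
    have "nat (int n + int K) = n + K" by linarith
    then show ?thesis using lam_gt_1 by (simp add: f_def \<epsilon>_def power_add field_simps)
  qed
  moreover have "(\<Sum>i<K. f i) = (\<Sum>n<K. real_of_int (\<epsilon> (- 1 - int n)) * lam ^ (n + 1))"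
  proof -
    have "f (K - Suc n) = real_of_int (\<epsilon> (- 1 - int n)) * lam ^ (n + 1)" if "n < K" for n
    proof -
      have "nat (- 1 - int n + int K) = K - Suc n" using that by linarith
      moreover have "K + 1 = (K - Suc n + 1) + (n + 1)" using that by simp
      then have "lam ^ (K + 1) = lam ^ (K - Suc n + 1) * lam ^ (n + 1)" by (metis power_add)
      ultimately show ?thesis using that lam_gt_1 by (simp add: f_def \<epsilon>_def)
    qed
    then have "(\<Sum>i<K. f (K - Suc i)) = (\<Sum>n<K. real_of_int (\<epsilon> (- 1 - int n)) * lam ^ (n + 1))"
      by (intro sum.cong) auto
    then show ?thesis by (simp only: sum.nat_diff_reindex)
  qed
  ultimately show thesis using that[OF 1 2] by (simp only:)
qed

section \<open>Limits of admissible sequences and of their digit series\<close>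

lemma compactum_bounds:
  assumes "\<epsilon> \<in> compactum r \<sigma>" shows "0 \<le> \<epsilon> n" "\<epsilon> n \<le> r"
proof -
  have "\<epsilon> n \<in> {0..r} \<or> \<epsilon> n \<in> {0..r - 1}"
    using assms unfolding compactum_def by (cases "\<sigma> = -1") simp_all
  then have "\<epsilon> n \<in> {0..r}" by auto
  then show "0 \<le> \<epsilon> n" "\<epsilon> n \<le> r" by auto
qed

text \<open>Every forbidden pattern occupies finitely many positions, and on a finite set the limit
  agrees with some single \<open>x k\<close>.\<close>

lemma compactum_pointwise_closed:
  assumes mem: "\<And>k :: nat. x k \<in> compactum r \<sigma>"
    and lim: "\<And>n. \<forall>\<^sub>F k in sequentially. x k n = \<epsilon> n"
  shows "\<epsilon> \<in> compactum r \<sigma>"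
proof -
  have ev: "\<exists>k. \<forall>n\<in>S. x k n = \<epsilon> n" if "finite S" for S
  proof -
    have "\<forall>\<^sub>F k in sequentially. \<forall>n\<in>S. x k n = \<epsilon> n"
      using that lim by (intro eventually_ball_finite) auto
    then show ?thesis using eventually_happens'[OF sequentially_bot] by blast
  qed
  show ?thesis
  proof (cases "\<sigma> = -1")
    case True
    have "\<epsilon> n \<in> {0..r} \<and> (\<epsilon> n = r \<longrightarrow> \<epsilon> (n + 1) = 0)" for n
    proof -
      obtain k where "x k n = \<epsilon> n" "x k (n + 1) = \<epsilon> (n + 1)"
        using ev[of "{n, n + 1}"] by auto
      moreover have "x k n \<in> {0..r} \<and> (x k n = r \<longrightarrow> x k (n + 1) = 0)"
        using mem[of k] True by (simp add: compactum_def)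
      ultimately show ?thesis by metis
    qed
    then show ?thesis using True by (simp add: compactum_def)
  next
    case False
    have "\<epsilon> n \<in> {0..r - 1}" for n
    proof -
      obtain k where "x k n = \<epsilon> n"
        using ev[of "{n}"] by auto
      moreover have "x k n \<in> {0..r - 1}"
        using mem[of k] False by (simp add: compactum_def)
      ultimately show ?thesis by metis
    qed
    moreover have False if a: "\<epsilon> n = r - 1" "\<forall>i\<in>{1..int j}. \<epsilon> (n + i) = r - 2"
      "\<epsilon> (n + int j + 1) = r - 1" for n j
    proof -
      obtain k where k: "\<forall>m\<in>{n..n + int j + 1}. x k m = \<epsilon> m"
        using ev[of "{n..n + int j + 1}"] by auto
      have "x k n = r - 1" "x k (n + int j + 1) = r - 1" using k a by auto
      moreover have "\<forall>i\<in>{1..int j}. x k (n + i) = r - 2" using k a(2) by auto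
      moreover have "\<not> (\<exists>n. \<exists>j :: nat. x k n = r - 1 \<and> (\<forall>i\<in>{1..int j}. x k (n + i) = r - 2) \<and>
          x k (n + int j + 1) = r - 1)"
        using mem[of k] False by (simp add: compactum_def)
      ultimately show False by metis
    qed
    ultimately show ?thesis using False unfolding compactum_def by auto
  qed
qed

text \<open>Tannery's theorem applies with the majorant \<open>r * \<bar>q\<bar> ^ n\<close>,
  uniform in \<open>k\<close>. It is used with \<open>q = 1 / lam\<close> for the nonnegative
  positions and \<open>q = mu\<close> for the negative ones.\<close>

lemma digit_series_tendsto:
  fixes x :: "nat \<Rightarrow> nat \<Rightarrow> int"
  assumes bd: "\<And>k n. \<bar>x k n\<bar> \<le> r" and lim: "\<And>n. \<forall>\<^sub>F k in sequentially. x k n = d n"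
    and q: "\<bar>q\<bar> < (1 :: real)"
  shows "summable (\<lambda>n. real_of_int (d n) * q ^ n)"
    and "(\<lambda>k. \<Sum>n. real_of_int (x k n) * q ^ n) \<longlonglongrightarrow> (\<Sum>n. real_of_int (d n) * q ^ n)"
proof -
  have A: "\<forall>\<^sub>F (n, k) in sequentially \<times>\<^sub>F sequentially. norm (real_of_int (x k n) * q ^ n) \<le> real_of_int r * \<bar>q\<bar> ^ n"
  proof (intro always_eventually, clarify)
    fix n k
    have "real_of_int \<bar>x k n\<bar> \<le> real_of_int r" using bd by (simp only: of_int_le_iff)
    then show "norm (real_of_int (x k n) * q ^ n) \<le> real_of_int r * \<bar>q\<bar> ^ n"
      by (simp add: abs_mult power_abs mult_right_mono)
  qed
  have B: "summable (\<lambda>n. real_of_int r * \<bar>q\<bar> ^ n)"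
    using q by (intro summable_mult summable_geometric) simp
  have C: "(\<lambda>k. real_of_int (x k n) * q ^ n) \<longlonglongrightarrow> real_of_int (d n) * q ^ n" for n
    by (intro tendsto_eventually eventually_mono[OF lim[of n]]) simp
  note T = tannerys_theorem[of "\<lambda>n k. real_of_int (x k n) * q ^ n" "\<lambda>n. real_of_int (d n) * q ^ n" sequentially, OF C A B]
  show "summable (\<lambda>n. real_of_int (d n) * q ^ n)"
    using T by (auto intro: summable_norm_cancel)
  show "(\<lambda>k. \<Sum>n. real_of_int (x k n) * q ^ n) \<longlonglongrightarrow> (\<Sum>n. real_of_int (d n) * q ^ n)"
    using T by auto
qed

lemma compactum_digit_bound: "\<epsilon> \<in> compactum r \<sigma> \<Longrightarrow> \<bar>\<epsilon> n\<bar> \<le> r"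
  using compactum_bounds[of \<epsilon> n] by simp

lemma digit_series_bound:
  assumes "\<And>n. \<bar>d n\<bar> \<le> r" "\<bar>q\<bar> < (1 :: real)"
  shows "summable (\<lambda>n. real_of_int (d n) * q ^ n)"
    and "\<bar>\<Sum>n. real_of_int (d n) * q ^ n\<bar> \<le> real_of_int r / (1 - \<bar>q\<bar>)"
proof -
  show s: "summable (\<lambda>n. real_of_int (d n) * q ^ n)"
    using digit_series_tendsto(1)[of "\<lambda>_. d" d q] assms by simp
  have le: "norm (real_of_int (d n) * q ^ n) \<le> real_of_int r * \<bar>q\<bar> ^ n" for n
  proof -
    have "real_of_int \<bar>d n\<bar> \<le> real_of_int r" using assms(1) by (simp only: of_int_le_iff)
    then show ?thesis by (simp add: abs_mult power_abs mult_right_mono)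
  qed
  have g: "(\<lambda>n. real_of_int r * \<bar>q\<bar> ^ n) sums (real_of_int r * (1 / (1 - \<bar>q\<bar>)))"
    using assms(2) by (intro sums_mult geometric_sums) simp
  have "norm (\<Sum>n. real_of_int (d n) * q ^ n) \<le> (\<Sum>n. real_of_int r * \<bar>q\<bar> ^ n)"
    by (rule norm_suminf_le[OF le sums_summable[OF g]])
  then show "\<bar>\<Sum>n. real_of_int (d n) * q ^ n\<bar> \<le> real_of_int r / (1 - \<bar>q\<bar>)"
    using sums_unique[OF g] by simp
qed

text \<open>In coordinates along the two eigenlines, this is surjectivity of the coding onto
  \<open>\<real>\<^sup>2/\<int>[\<lambda>]\<close>. Greedy expansions cover a half-line of the unstable direction, which is dense
  modulo \<open>\<int>[\<lambda>]\<close>; bounded elements of \<open>\<int>[\<lambda>]\<close> are finite in number, so a subsequence of the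
  approximating expansions has a constant lattice part and a limit in the compactum.\<close>

theorem compactum_coding_surjective:
  obtains \<epsilon> i j where "\<epsilon> \<in> compactum r \<sigma>"
    "(\<lambda>n. real_of_int (\<epsilon> (int n)) / lam ^ n) sums (u - (real_of_int i + real_of_int j * lam))"
    "(\<lambda>n. real_of_int (\<epsilon> (- 1 - int n)) * mu ^ (n + 1)) sums ((real_of_int i + real_of_int j * mu) - v)"
proof -
  \<comment> \<open>The condition is exact in the unstable coordinate \<open>u\<close> and
    approximate in the stable coordinate \<open>v\<close>. The sign of the second condition is
    reversed because digits at negative positions contribute \<open>- mu ^ (n + 1)\<close> to the
    stable coordinate.\<close>
  define P where "P = (\<lambda>(k :: nat) \<epsilon> i j. \<epsilon> \<in> compactum r \<sigma> \<and>
      (\<lambda>n. real_of_int (\<epsilon> (int n)) / lam ^ n) sums (u - (real_of_int i + real_of_int j * lam)) \<and>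
      \<bar>(\<Sum>n. real_of_int (\<epsilon> (- 1 - int n)) * mu ^ n) * mu - ((real_of_int i + real_of_int j * mu) - v)\<bar>
        < 1 / real (Suc k))"
  have "\<exists>\<epsilon> i j. P k \<epsilon> i j" for k
  proof -
    obtain a b where ab: "(a, b) \<in> conj_pairs" "a \<le> u" "\<bar>b - v\<bar> < 1 / real (Suc k)"
      using conj_approx[of "1 / real (Suc k)" u v] by auto
    have "u - a \<ge> 0" using ab by simp
    then obtain \<epsilon> K where e: "\<epsilon> \<in> compactum r \<sigma>" and K: "\<And>n. n \<ge> K \<Longrightarrow> \<epsilon> (- 1 - int n) = 0"
      and s: "(\<lambda>n. real_of_int (\<epsilon> (int n)) / lam ^ n) sums
        (u - a - (\<Sum>n<K. real_of_int (\<epsilon> (- 1 - int n)) * lam ^ (n + 1)))"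
      using greedy_expansion by blast
    obtain i j where ij: "a + (\<Sum>n<K. real_of_int (\<epsilon> (- 1 - int n)) * lam ^ (n + 1)) = real_of_int i + real_of_int j * lam"
      "b + (\<Sum>n<K. real_of_int (\<epsilon> (- 1 - int n)) * mu ^ (n + 1)) = real_of_int i + real_of_int j * mu"
      by (rule conj_pairsE[OF conj_pairs_add[OF ab(1) conj_pairs_digit_sum[of "\<lambda>n. \<epsilon> (- 1 - int n)" K]]])
    have "(\<Sum>n. real_of_int (\<epsilon> (- 1 - int n)) * mu ^ n) = (\<Sum>n<K. real_of_int (\<epsilon> (- 1 - int n)) * mu ^ n)"
      using K by (intro suminf_finite) auto
    then have "(\<Sum>n. real_of_int (\<epsilon> (- 1 - int n)) * mu ^ n) * mu = (\<Sum>n<K. real_of_int (\<epsilon> (- 1 - int n)) * mu ^ (n + 1))"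
      by (simp add: sum_distrib_right mult.assoc mult.commute[of mu])
    also have "\<dots> = (real_of_int i + real_of_int j * mu) - b" using ij(2) by linarith
    finally have "\<bar>(\<Sum>n. real_of_int (\<epsilon> (- 1 - int n)) * mu ^ n) * mu - ((real_of_int i + real_of_int j * mu) - v)\<bar>
        < 1 / real (Suc k)"
      using ab(3) by simp
    moreover have "u - a - (\<Sum>n<K. real_of_int (\<epsilon> (- 1 - int n)) * lam ^ (n + 1)) = u - (real_of_int i + real_of_int j * lam)"
      using ij(1) by linarith
    ultimately show ?thesis using e s unfolding P_def by (intro exI conjI) (assumption, simp only:, assumption)
  qed
  then obtain E I J where "\<And>k. P k (E k) (I k) (J k)" by metis
  then have E: "\<And>k. E k \<in> compactum r \<sigma>"
    and A: "\<And>k. (\<lambda>n. real_of_int (E k (int n)) / lam ^ n) sums (u - (real_of_int (I k) + real_of_int (J k) * lam))"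
    and B: "\<And>k. \<bar>(\<Sum>n. real_of_int (E k (- 1 - int n)) * mu ^ n) * mu
        - ((real_of_int (I k) + real_of_int (J k) * mu) - v)\<bar> < 1 / real (Suc k)"
    unfolding P_def by blast+
  have Eb: "\<bar>E k n\<bar> \<le> r" for k n using compactum_digit_bound[OF E] .
  have il: "\<bar>1 / lam\<bar> < 1" using lam_gt_1 by simp
  have A': "(\<Sum>n. real_of_int (E k (int n)) * (1 / lam) ^ n) = u - (real_of_int (I k) + real_of_int (J k) * lam)" for k
    using sums_unique[OF A[of k]] by (simp add: power_one_over)
  \<comment> \<open>The constant dominates both digit series; the last summand covers the
    approximation error \<open>1 / Suc k\<close>.\<close>
  define C where "C = real_of_int r / (1 - \<bar>1 / lam\<bar>) + real_of_int r / (1 - \<bar>mu\<bar>) + 1"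
  have pos: "real_of_int r / (1 - \<bar>1 / lam\<bar>) \<ge> 0" "real_of_int r / (1 - \<bar>mu\<bar>) \<ge> 0"
    using r_pos il abs_mu_less_1 by (auto intro!: divide_nonneg_pos)
  have 1: "\<bar>real_of_int (I k) + real_of_int (J k) * lam - u\<bar> \<le> C" for k
    using digit_series_bound(2)[of "\<lambda>n. E k (int n)", OF Eb il] pos unfolding A' C_def by linarith
  have 2: "\<bar>real_of_int (I k) + real_of_int (J k) * mu - v\<bar> \<le> C" for k
  proof -
    have "\<bar>\<Sum>n. real_of_int (E k (- 1 - int n)) * mu ^ n\<bar> \<le> real_of_int r / (1 - \<bar>mu\<bar>)"
      using digit_series_bound(2)[of "\<lambda>n. E k (- 1 - int n)", OF Eb abs_mu_less_1] .
    moreover have "\<bar>(\<Sum>n. real_of_int (E k (- 1 - int n)) * mu ^ n) * mu\<bar> \<le> \<bar>\<Sum>n. real_of_int (E k (- 1 - int n)) * mu ^ n\<bar>"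
      using abs_mu_less_1 by (simp add: abs_mult mult_left_le)
    moreover have "1 / real (Suc k) \<le> 1" by simp
    ultimately show ?thesis using B[of k] pos unfolding C_def by linarith
  qed
  define W where "W = C + \<bar>v\<bar> + (2 * C + \<bar>u\<bar> + \<bar>v\<bar>) / (lam - mu)"
  have C0: "C \<ge> 0" using pos unfolding C_def by linarith
  have "\<bar>real_of_int (I k)\<bar> \<le> W" "\<bar>real_of_int (J k)\<bar> \<le> W" for k
    using conj_pair_coords_bound[OF 1[of k] 2[of k]] C0 unfolding W_def by linarith+
  then have IJ: "\<bar>I k\<bar> \<le> \<lfloor>W\<rfloor>" "\<bar>J k\<bar> \<le> \<lfloor>W\<rfloor>" for k
    by (simp_all add: le_floor_iff)
  \<comment> \<open>Packing all digits and both lattice coordinates into one countable index type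
    lets a single subsequence stabilise them together.\<close>
  define x :: "nat \<Rightarrow> int + bool \<Rightarrow> int" where
    "x = (\<lambda>k. case_sum (E k) (\<lambda>b. if b then I k else J k))"
  have xb: "\<bar>x k a\<bar> \<le> max r \<lfloor>W\<rfloor>" for k a
    using Eb[of k] IJ[of k] by (auto simp: x_def max_def split: sum.split) (meson order_trans linear)+
  obtain f l where f: "strict_mono (f :: nat \<Rightarrow> nat)" and l: "\<And>a. \<forall>\<^sub>F k in sequentially. x (f k) a = l a"
    using pointwise_constant_subsequence[of x "\<lambda>_. max r \<lfloor>W\<rfloor>", OF xb] by blast
  define \<epsilon> where "\<epsilon> = (\<lambda>n. l (Inl n))"
  define i where "i = l (Inr True)"
  define j where "j = l (Inr False)"
  have le: "\<forall>\<^sub>F k in sequentially. E (f k) n = \<epsilon> n" for n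
    using l[of "Inl n"] by (simp add: x_def \<epsilon>_def)
  have "\<forall>\<^sub>F k in sequentially. I (f k) = i" "\<forall>\<^sub>F k in sequentially. J (f k) = j"
    using l[of "Inr True"] l[of "Inr False"] by (simp_all add: x_def i_def j_def)
  then have lij: "\<forall>\<^sub>F k in sequentially. I (f k) = i \<and> J (f k) = j"
    by (rule eventually_conj)
  have e: "\<epsilon> \<in> compactum r \<sigma>"
    using compactum_pointwise_closed[of "\<lambda>k. E (f k)", OF E le] .
  have eb: "\<bar>\<epsilon> n\<bar> \<le> r" for n using compactum_digit_bound[OF e] .
  have "(\<lambda>k. \<Sum>n. real_of_int (E (f k) (int n)) * (1 / lam) ^ n) \<longlonglongrightarrow> (\<Sum>n. real_of_int (\<epsilon> (int n)) * (1 / lam) ^ n)"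
    using digit_series_tendsto(2)[of "\<lambda>k n. E (f k) (int n)", OF Eb le il] .
  moreover have "(\<lambda>k. \<Sum>n. real_of_int (E (f k) (int n)) * (1 / lam) ^ n) \<longlonglongrightarrow> u - (real_of_int i + real_of_int j * lam)"
    unfolding A' by (intro tendsto_eventually eventually_mono[OF lij]) simp
  ultimately have "(\<Sum>n. real_of_int (\<epsilon> (int n)) * (1 / lam) ^ n) = u - (real_of_int i + real_of_int j * lam)"
    by (rule LIMSEQ_unique)
  moreover have "(\<lambda>n. real_of_int (\<epsilon> (int n)) * (1 / lam) ^ n) sums (\<Sum>n. real_of_int (\<epsilon> (int n)) * (1 / lam) ^ n)"
    using digit_series_bound(1)[of "\<lambda>n. \<epsilon> (int n)", OF eb il] by (rule summable_sums)
  ultimately have s1: "(\<lambda>n. real_of_int (\<epsilon> (int n)) / lam ^ n) sums (u - (real_of_int i + real_of_int j * lam))"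
    by (simp add: power_one_over)
  let ?B = "\<lambda>k. \<Sum>n. real_of_int (E k (- 1 - int n)) * mu ^ n"
  have "(\<lambda>k. ?B (f k)) \<longlonglongrightarrow> (\<Sum>n. real_of_int (\<epsilon> (- 1 - int n)) * mu ^ n)"
    using digit_series_tendsto(2)[of "\<lambda>k n. E (f k) (- 1 - int n)", OF Eb le abs_mu_less_1] .
  then have "(\<lambda>k. ?B (f k) * mu) \<longlonglongrightarrow> (\<Sum>n. real_of_int (\<epsilon> (- 1 - int n)) * mu ^ n) * mu"
    by (intro tendsto_mult_right)
  moreover have "(\<lambda>k. ?B (f k) * mu) \<longlonglongrightarrow> (real_of_int i + real_of_int j * mu) - v"
  proof -
    have "(\<lambda>k. 1 / real (Suc k)) \<longlonglongrightarrow> 0"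
      by (rule lim_1_over_n[THEN LIMSEQ_Suc])
    then have "(\<lambda>k. 1 / real (Suc (f k))) \<longlonglongrightarrow> 0"
      using LIMSEQ_subseq_LIMSEQ[OF _ f] by (simp add: o_def)
    moreover have "norm (?B k * mu - ((real_of_int (I k) + real_of_int (J k) * mu) - v)) \<le> 1 / real (Suc k)" for k
      using B[of k] by simp
    ultimately have "(\<lambda>k. ?B (f k) * mu - ((real_of_int (I (f k)) + real_of_int (J (f k)) * mu) - v)) \<longlonglongrightarrow> 0"
      by (rule Lim_null_comparison[OF always_eventually[OF allI], rotated])
    moreover have "(\<lambda>k. (real_of_int (I (f k)) + real_of_int (J (f k)) * mu) - v) \<longlonglongrightarrow> (real_of_int i + real_of_int j * mu) - v"
      by (intro tendsto_eventually eventually_mono[OF lij]) simp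
    ultimately show ?thesis
      using tendsto_add by fastforce
  qed
  ultimately have B': "(\<Sum>n. real_of_int (\<epsilon> (- 1 - int n)) * mu ^ n) * mu = (real_of_int i + real_of_int j * mu) - v"
    by (rule LIMSEQ_unique)
  have "(\<lambda>n. real_of_int (\<epsilon> (- 1 - int n)) * mu ^ n * mu) sums ((\<Sum>n. real_of_int (\<epsilon> (- 1 - int n)) * mu ^ n) * mu)"
    by (intro sums_mult2 summable_sums digit_series_bound(1) eb abs_mu_less_1)
  then have "(\<lambda>n. real_of_int (\<epsilon> (- 1 - int n)) * mu ^ (n + 1)) sums ((real_of_int i + real_of_int j * mu) - v)"
    unfolding B' by (simp add: mult_ac)
  then show thesis using that e s1 by blast
qed

subsection \<open>The unit group\<close>

text \<open>These are the units of the order generated by \<open>lam\<close>, each with its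
  conjugate, recognised by their norm \<open>a * b\<close>.\<close>

definition unit_pairs :: "(real \<times> real) set" where
  "unit_pairs = {(a, b) \<in> conj_pairs. a * b = 1 \<or> a * b = -1}"

lemma unit_pairs_iff: "(a, b) \<in> unit_pairs \<longleftrightarrow> (a, b) \<in> conj_pairs \<and> (a * b = 1 \<or> a * b = -1)"
  by (simp add: unit_pairs_def)

lemma unit_pairs_nonzero: "(a, b) \<in> unit_pairs \<Longrightarrow> a \<noteq> 0 \<and> b \<noteq> 0"
  by (auto simp: unit_pairs_iff)

lemma unit_pairs_lam: "(lam, mu) \<in> unit_pairs"
  using conj_pairs_lam lam_times_mu sigma by (auto simp: unit_pairs_iff)

lemma unit_pairs_mult:
  assumes "(a, b) \<in> unit_pairs" "(c, d) \<in> unit_pairs"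
  shows "(a * c, b * d) \<in> unit_pairs"
proof -
  have "(a * c) * (b * d) = (a * b) * (c * d)" by (simp add: mult_ac)
  moreover have "(a * b) * (c * d) = 1 \<or> (a * b) * (c * d) = -1"
    using assms unfolding unit_pairs_iff by auto
  ultimately have "(a * c) * (b * d) = 1 \<or> (a * c) * (b * d) = -1" by (simp only:)
  then show ?thesis using assms conj_pairs_mult unfolding unit_pairs_iff by blast
qed

lemma unit_pairs_uminus: "(a, b) \<in> unit_pairs \<Longrightarrow> (- a, - b) \<in> unit_pairs"
  by (simp add: unit_pairs_iff conj_pairs_uminus)

text \<open>The inverse of a unit is its conjugate up to sign, and the order is stable under
  conjugation.\<close>

lemma unit_pairs_inverse:
  assumes "(a, b) \<in> unit_pairs" shows "(1 / a, 1 / b) \<in> unit_pairs"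
proof -
  have ab: "(a, b) \<in> conj_pairs" "a * b = 1 \<or> a * b = -1" and nz: "a \<noteq> 0" "b \<noteq> 0"
    using assms unit_pairs_nonzero by (auto simp: unit_pairs_iff)
  have "(1 / a, 1 / b) \<in> conj_pairs"
  proof (cases "a * b = 1")
    case True
    then have "1 / a = b" "1 / b = a" using nz by (simp_all add: field_simps)
    then show ?thesis using conj_pairs_swap[OF ab(1)] by simp
  next
    case False
    then have "1 / a = - b" "1 / b = - a" using ab(2) nz by (simp_all add: field_simps)
    then show ?thesis using conj_pairs_uminus[OF conj_pairs_swap[OF ab(1)]] by simp
  qed
  moreover have "(1 / a) * (1 / b) = 1 / (a * b)" by simp
  ultimately show ?thesis using ab(2) by (simp only: unit_pairs_iff) auto
qed

lemma unit_pairs_powi: "(a, b) \<in> unit_pairs \<Longrightarrow> (a powi k, b powi k) \<in> unit_pairs"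
proof -
  assume ab: "(a, b) \<in> unit_pairs"
  have one: "(1, 1) \<in> unit_pairs" by (simp add: unit_pairs_iff conj_pairs_1)
  have p: "(a ^ n, b ^ n) \<in> unit_pairs" for n
    by (induction n) (use one ab unit_pairs_mult in auto)
  show ?thesis
  proof (cases "k \<ge> 0")
    case True
    then show ?thesis using p[of "nat k"] by (simp add: power_int_def)
  next
    case False
    then show ?thesis using unit_pairs_inverse[OF p[of "nat (- k)"]]
      by (simp add: power_int_def power_one_over inverse_eq_divide)
  qed
qed

lemma unit_pairs_trace:
  assumes "(a, b) \<in> unit_pairs"
  obtains n :: int where "a + b = real_of_int n"
proof -
  obtain i j where "a = real_of_int i + real_of_int j * lam" "b = real_of_int i + real_of_int j * mu"
    using assms unfolding unit_pairs_iff by (blast elim: conj_pairsE)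
  then have "a + b = real_of_int (2 * i) + real_of_int j * (lam + mu)" by (simp add: algebra_simps)
  then show thesis using that[of "2 * i + j * r"] by (simp add: lam_plus_mu)
qed

text \<open>The trace \<open>a + b\<close> is an integer. With norm 1 it would be
  \<open>a + 1 / a\<close>, strictly between 2 and 3; so the norm is -1 and the positive integer
  \<open>a - 1 / a\<close> is at least 1.\<close>

lemma unit_pairs_no_fractional_trace:
  assumes "(a, b) \<in> unit_pairs" "1 < a" "a < 2"
  shows "a * b = -1" and "a - 1 / a \<ge> 1"
proof -
  obtain n where n: "a + b = real_of_int n" using unit_pairs_trace[OF assms(1)] .
  have inv: "0 < 1 / a" "1 / a < 1" using assms by simp_all
  have ab: "a * b = 1 \<or> a * b = -1" using assms(1) by (simp add: unit_pairs_iff)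
  show m: "a * b = -1"
  proof (rule ccontr)
    assume "a * b \<noteq> -1"
    then have b: "b = 1 / a" using ab assms(2) by (simp add: field_simps)
    have "0 < (a - 1) * (a - 1)" using assms(2) by simp
    then have "a + 1 / a > 2" using assms(2) by (simp add: field_simps)
    then have "real_of_int 2 < real_of_int n" "real_of_int n < real_of_int 3"
      using n b inv assms(3) by simp_all
    then show False unfolding of_int_less_iff by simp
  qed
  then have b: "b = - 1 / a" using assms(2) by (simp add: field_simps)
  then have "real_of_int n = a - 1 / a" using n by simp
  moreover from this have "real_of_int n > 0" using inv assms(2) by linarith
  then have "n \<ge> 1" by simp
  then have "real_of_int n \<ge> 1" by simp
  ultimately show "a - 1 / a \<ge> 1" by simp
qed

text \<open>The inequality \<open>a - 1 / a \<ge> 1\<close> holds only from the golden ratio on;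
  \<open>3 / 2\<close> is a convenient rational below it.\<close>

lemma unit_pairs_gap:
  assumes "(a, b) \<in> unit_pairs" "1 < a"
  shows "a \<ge> 3 / 2"
proof (rule ccontr)
  assume a: "\<not> a \<ge> 3 / 2"
  then have "a - 1 / a \<ge> 1" using unit_pairs_no_fractional_trace(2)[OF assms] by simp
  moreover have "1 / a > 1 / (3 / 2)" using a assms(2) by (intro divide_strict_left_mono) auto
  ultimately show False using a by simp
qed

text \<open>Dividing a positive unit by a suitable power of \<open>\<theta>\<close> puts it into
  \<open>[1, \<theta>)\<close>, where minimality leaves only 1. The sign \<open>s\<close> takes care
  of negative units.\<close>

lemma unit_pairs_generated:
  assumes g: "(\<theta>, \<theta>') \<in> unit_pairs" "\<theta> > 1"
    and min: "\<And>a b. (a, b) \<in> unit_pairs \<Longrightarrow> 1 < a \<Longrightarrow> \<theta> \<le> a"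
    and ab: "(a, b) \<in> unit_pairs"
  obtains k :: int and s :: real where "s \<in> {1, -1}" "a = s * \<theta> powi k"
proof -
  have *: "\<exists>k :: int. c = \<theta> powi k" if cd: "(c, d) \<in> unit_pairs" "c > 0" for c d
  proof -
    define k where "k = \<lfloor>log \<theta> c\<rfloor>"
    have "\<theta> powr real_of_int k \<le> \<theta> powr log \<theta> c"
      using g(2) by (intro powr_mono) (auto simp: k_def)
    then have lo: "\<theta> powi k \<le> c" using g(2) cd(2) by (simp add: powr_real_of_int')
    have "\<theta> powr log \<theta> c < \<theta> powr real_of_int (k + 1)"
      using g(2) by (intro powr_less_mono) (auto simp: k_def)
    then have "c < \<theta> powi (k + 1)" using g(2) cd(2) powr_real_of_int'[of \<theta> "k + 1"] by simp
    then have hi: "c < \<theta> powi k * \<theta>" using g(2) by (simp add: power_int_add)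
    have p: "\<theta> powi k > 0" using g(2) by (simp add: zero_less_power_int)
    have u: "(c * \<theta> powi (- k), d * \<theta>' powi (- k)) \<in> unit_pairs"
      by (intro unit_pairs_mult cd unit_pairs_powi g)
    have e: "c * \<theta> powi (- k) = c / \<theta> powi k" by (simp add: power_int_minus divide_inverse)
    have "c / \<theta> powi k < \<theta>" using hi p by (simp add: field_simps)
    then have "\<not> 1 < c / \<theta> powi k" using min[OF u] unfolding e by linarith
    then have "c = \<theta> powi k" using lo p by (simp add: field_simps)
    then show ?thesis by blast
  qed
  show thesis
  proof (cases "a > 0")
    case True
    then show thesis using *[OF ab] that[of 1] by auto
  next
    case False
    then have "- a > 0" using unit_pairs_nonzero[OF ab] by auto
    then obtain k :: int where "- a = \<theta> powi k" using *[OF unit_pairs_uminus[OF ab]] by blast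
    then show thesis using that[of "-1" k] by simp
  qed
qed

text \<open>By the gap, distinct positive units differ by a factor of at least \<open>3 / 2\<close>.
  A unit closer than that factor to the infimum therefore attains it.\<close>

lemma fundamental_unit_exists:
  obtains \<theta> \<theta>' where "(\<theta>, \<theta>') \<in> unit_pairs" "\<theta> > 1"
    "\<forall>a b. (a, b) \<in> unit_pairs \<longrightarrow> 1 < a \<longrightarrow> \<theta> \<le> a"
proof -
  define S where "S = {a. a > 1 \<and> (\<exists>b. (a, b) \<in> unit_pairs)}"
  have ne: "lam \<in> S" using unit_pairs_lam lam_gt_1 by (auto simp: S_def)
  have bd: "bdd_below S" by (rule bdd_belowI[of _ 1]) (auto simp: S_def)
  have low: "3 / 2 \<le> Inf S" using ne unit_pairs_gap by (intro cInf_greatest) (auto simp: S_def)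
  then have "Inf S < Inf S * (3 / 2)" by simp
  then obtain \<theta> where t: "\<theta> \<in> S" "\<theta> < Inf S * (3 / 2)"
    using cInf_lessD[of S] ne by blast
  then obtain \<theta>' where t': "(\<theta>, \<theta>') \<in> unit_pairs" "\<theta> > 1" by (auto simp: S_def)
  have "\<theta> \<le> a" if ab: "(a, b) \<in> unit_pairs" "1 < a" for a b
  proof (rule ccontr)
    assume n: "\<not> \<theta> \<le> a"
    have aS: "Inf S \<le> a" using ab bd by (intro cInf_lower) (auto simp: S_def)
    have u: "(\<theta> * (1 / a), \<theta>' * (1 / b)) \<in> unit_pairs"
      by (intro unit_pairs_mult t' unit_pairs_inverse ab)
    have "\<theta> * (1 / a) > 1" using n ab(2) by simp
    then have "\<theta> * (1 / a) \<ge> 3 / 2" by (rule unit_pairs_gap[OF u])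
    then have "\<theta> \<ge> a * (3 / 2)" using ab(2) by (simp add: field_simps)
    then show False using t(2) aS by linarith
  qed
  then show thesis using that t' by blast
qed

text \<open>The number \<open>lam - 1\<close> has norm \<open>1 - 3 + 1 = -1\<close> and square
  \<open>lam\<close>. It solves \<open>a * (a - 1) = 1\<close>, so a smaller unit above 1 would
  violate \<open>a - 1 / a \<ge> 1\<close>.\<close>

lemma golden_unit:
  assumes "r = 3" "\<sigma> = 1"
  shows "lam = (3 + sqrt 5) / 2" and "sqrt lam = (1 + sqrt 5) / 2"
    and "\<exists>g'. (sqrt lam, g') \<in> unit_pairs"
    and "(a, b) \<in> unit_pairs \<Longrightarrow> 1 < a \<Longrightarrow> sqrt lam \<le> a"
proof -
  have "real_of_int (r\<^sup>2 - 4 * \<sigma>) = 5" "real_of_int r = 3" using assms by simp_all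
  then show l: "lam = (3 + sqrt 5) / 2" unfolding lam_def by (simp only:)
  define g where "g = (1 + sqrt 5) / 2"
  have s5: "sqrt 5 * sqrt 5 = (5 :: real)" by simp
  have g2: "g * g = lam" "g = lam - 1" "g * g = g + 1" unfolding g_def l using s5 by (simp_all add: field_simps)
  have gp: "g > 0" by (simp add: g_def add_pos_pos)
  have gs: "sqrt lam = g" using gp g2(1) by (metis real_sqrt_unique power2_eq_square less_imp_le)
  then show "sqrt lam = (1 + sqrt 5) / 2" by (simp add: g_def)
  have "(lam + (-1), mu + (-1)) \<in> conj_pairs"
    using conj_pairs_add[OF conj_pairs_lam conj_pairs_int[of "-1"]] by simp
  moreover have "(lam + (-1)) * (mu + (-1)) = -1"
  proof -
    have "(lam + (-1)) * (mu + (-1)) = lam * mu - (lam + mu) + 1" by (simp add: algebra_simps)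
    then show ?thesis using assms lam_times_mu lam_plus_mu by simp
  qed
  ultimately show "\<exists>g'. (sqrt lam, g') \<in> unit_pairs"
    unfolding gs g2(2) unit_pairs_iff by (intro exI[of _ "mu - 1"]) simp
  assume ab: "(a, b) \<in> unit_pairs" "1 < a"
  show "sqrt lam \<le> a"
  proof (rule ccontr)
    assume "\<not> sqrt lam \<le> a"
    then have a: "a < g" using gs by simp
    have "sqrt 5 < sqrt (3 * 3)" by (simp only: real_sqrt_less_iff)
    then have "sqrt 5 < 3" by simp
    then have "g < 2" by (simp add: g_def)
    then have "a - 1 / a \<ge> 1" using unit_pairs_no_fractional_trace(2)[OF ab] a by simp
    then have "a * (a - 1) \<ge> 1" using ab(2) by (simp add: field_simps)
    moreover have "a * (a - 1) < g * (g - 1)" using a ab(2) by (intro mult_strict_mono) auto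
    moreover have "g * (g - 1) = 1" using g2(3) by (simp add: algebra_simps)
    ultimately show False by simp
  qed
qed

end

section \<open>Integer matrices\<close>

lemma det_int_2: "det (K :: int^2^2) = K$1$1 * K$2$2 - K$1$2 * K$2$1"
  by (rule det_2)

lemma trace_int_2: "trace (K :: int^2^2) = K$1$1 + K$2$2"
  by (simp add: trace_def sum_2)

lemma mat2_eq_iff: "(A :: 'a^2^2) = B \<longleftrightarrow> A$1$1 = B$1$1 \<and> A$1$2 = B$1$2 \<and> A$2$1 = B$2$1 \<and> A$2$2 = B$2$2"
  by (auto simp: vec_eq_iff forall_2)

lemma mult_int_2: "((A :: int^2^2) ** B)$a$b = A$a$1 * B$1$b + A$a$2 * B$2$b"
  by (simp add: matrix_matrix_mult_def sum_2)

lemma mat_1_int_2 [simp]: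
  "(mat 1 :: int^2^2)$1$1 = 1" "(mat 1 :: int^2^2)$1$2 = 0" "(mat 1 :: int^2^2)$2$1 = 0" "(mat 1 :: int^2^2)$2$2 = 1"
  by (simp_all add: mat_def)

lemma adjugate_inverse_int_2:
  fixes K :: "int^2^2"
  assumes "det K * det K = 1"
  defines "B \<equiv> vector [vector [det K * K$2$2, - det K * K$1$2], vector [- det K * K$2$1, det K * K$1$1]]"
  shows "B ** K = mat 1" "K ** B = mat 1"
  using assms(1)
  by (auto simp: mat2_eq_iff mult_int_2 B_def det_int_2 vector_2 algebra_simps)

lemma invertible_int_2: "invertible (K :: int^2^2) \<longleftrightarrow> det K = 1 \<or> det K = -1"
proof
  assume "invertible K"
  then obtain B where "K ** B = mat 1" unfolding invertible_def by blast
  then have "det K * det B = 1" by (metis det_mul det_I)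
  then show "det K = 1 \<or> det K = -1" by (simp add: zmult_eq_1_iff) blast
next
  assume "det K = 1 \<or> det K = -1"
  then have "det K * det K = 1" by auto
  from adjugate_inverse_int_2[OF this] show "invertible K" unfolding invertible_def by blast
qed

text \<open>This is the element \<open>i + j K\<close> of the commutative ring generated by
  \<open>K\<close>, written entrywise; Cayley-Hamilton closes the family under products.\<close>

definition lin :: "int^2^2 \<Rightarrow> int \<Rightarrow> int \<Rightarrow> int^2^2" where
  "lin K i j = (\<chi> a b. (if a = b then i else 0) + j * K$a$b)"

lemma lin_simps [simp]:
  "lin K i j $1$1 = i + j * K$1$1" "lin K i j $1$2 = j * K$1$2"
  "lin K i j $2$1 = j * K$2$1" "lin K i j $2$2 = i + j * K$2$2"
  by (simp_all add: lin_def)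

lemma lin_0_1: "lin K 0 1 = K" and lin_1_0: "lin K 1 0 = mat 1"
  by (simp_all add: mat2_eq_iff)

lemma lin_mult:
  "lin K i j ** lin K k l = lin K (i * k - j * l * det K) (i * l + j * k + j * l * trace K)"
  by (simp add: mat2_eq_iff mult_int_2 det_int_2 trace_int_2 algebra_simps)

lemma det_lin: "det (lin K i j) = i\<^sup>2 + i * j * trace K + j\<^sup>2 * det K"
  by (simp add: det_int_2 trace_int_2 algebra_simps power2_eq_square)

lemma trace_lin: "trace (lin K i j) = 2 * i + j * trace K"
  by (simp add: trace_int_2 algebra_simps)

text \<open>Since \<open>q\<close> is its own inverse, \<open>M = p + q K\<close> can be solved for
  \<open>K = - p q + q M\<close>.\<close>

lemma lin_lin_unit:
  assumes "q * q = 1"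
  shows "lin (lin K p q) (- p * q) q = K"
  using assms by (simp add: mat2_eq_iff algebra_simps)

text \<open>Up to sign and a change of variables the form is the determinant of a vector and its
  image, so the scalar part \<open>p\<close> drops out and \<open>q\<close> factors out.\<close>

lemma quad_form_lin: "quad_form (lin K p q) x y = q * quad_form K x y"
  by (simp add: quad_form_def algebra_simps)

lemma mat_power_0: "mat_power K 0 = mat 1" and mat_power_Suc: "mat_power K (Suc n) = K ** mat_power K n"
  by (simp_all add: mat_power_def)

lemma mat_power_2: "mat_power K 2 = K ** K"
  by (simp add: numeral_2_eq_2 mat_power_Suc mat_power_0)

lemma det_mat_power: "det (mat_power K n) = det K ^ n"
  by (induction n) (simp_all add: mat_power_0 mat_power_Suc det_mul)

lemma mat_power_eq_lin:
  obtains p q where "mat_power K n = lin K p q"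
proof (induction n arbitrary: thesis)
  case 0
  then show ?case by (metis lin_1_0 mat_power_0)
next
  case (Suc n)
  obtain p q where "mat_power K n = lin K p q" using Suc.IH by blast
  then have "mat_power K (Suc n) = lin K 0 1 ** lin K p q" by (simp add: mat_power_Suc lin_0_1)
  then show ?case using Suc.prems unfolding lin_mult by blast
qed

section \<open>Powers inside the ring generated by \<open>M\<close>\<close>

locale hyperbolic_matrix =
  fixes M :: "int^2^2"
  assumes det_M: "det M = 1 \<or> det M = -1" and trace_pos: "trace M > 0"
    and trace_ge_3: "det M = 1 \<Longrightarrow> trace M \<ge> 3"
begin

sublocale quadratic_unit "trace M" "det M"
  using det_M trace_pos trace_ge_3 by unfold_locales auto

lemma lead_eigenvalue_eq: "lead_eigenvalue M = lam"
  by (simp add: lead_eigenvalue_def lam_def)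

lemma disc_eq: "(trace M)\<^sup>2 - 4 * det M = (M$1$1 - M$2$2)\<^sup>2 + 4 * M$1$2 * M$2$1"
  by (simp add: trace_int_2 det_int_2 power2_eq_square algebra_simps)

lemma off_diagonal_nonzero: "M$1$2 \<noteq> 0" "M$2$1 \<noteq> 0"
  using disc_not_square[of "M$1$1 - M$2$2"] disc_eq by auto

lemma lin_M_inject: "lin M p q = M \<Longrightarrow> p = 0 \<and> q = 1"
  using off_diagonal_nonzero by (auto simp: mat2_eq_iff)

text \<open>Sending \<open>M\<close> to \<open>lam\<close> is a ring homomorphism, as both satisfy
  the same quadratic equation; matrix powers are thus computed as powers of reals.\<close>

lemma mat_power_lin:
  obtains p q where "mat_power (lin M i j) n = lin M p q"
    "(real_of_int i + real_of_int j * lam) ^ n = real_of_int p + real_of_int q * lam"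
proof (induction n arbitrary: thesis)
  case 0
  then show ?case using 0[of 1 0] by (simp add: lin_1_0 mat_power_0)
next
  case (Suc n)
  obtain p q where pq: "mat_power (lin M i j) n = lin M p q"
    "(real_of_int i + real_of_int j * lam) ^ n = real_of_int p + real_of_int q * lam" using Suc.IH by blast
  have "(real_of_int i + real_of_int j * lam) * (real_of_int p + real_of_int q * lam)
      = real_of_int (i * p) + real_of_int (i * q + j * p) * lam + real_of_int (j * q) * (lam * lam)"
    by (simp add: algebra_simps)
  also have "\<dots> = real_of_int (i * p - j * q * det M) + real_of_int (i * q + j * p + j * q * trace M) * lam"
    unfolding lam_square by (simp add: algebra_simps)
  finally show ?case
    using Suc.prems pq by (simp add: mat_power_Suc lin_mult)
qed

lemma mat_power_lin_eq_M_iff: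
  "mat_power (lin M i j) n = M \<longleftrightarrow> (real_of_int i + real_of_int j * lam) ^ n = lam"
proof -
  obtain p q where pq: "mat_power (lin M i j) n = lin M p q"
    "(real_of_int i + real_of_int j * lam) ^ n = real_of_int p + real_of_int q * lam"
    by (rule mat_power_lin)
  have "lin M p q = M \<longleftrightarrow> p = 0 \<and> q = 1" using lin_M_inject lin_0_1 by blast
  also have "\<dots> \<longleftrightarrow> real_of_int p + real_of_int q * lam = lam"
    using lam_coords_unique[of p q 0 1] by auto
  finally show ?thesis using pq by simp
qed

lemma norm_eq_det_lin:
  "(real_of_int i + real_of_int j * lam) * (real_of_int i + real_of_int j * mu) = real_of_int (det (lin M i j))"
proof -
  have "(real_of_int i + real_of_int j * lam) * (real_of_int i + real_of_int j * mu)
      = real_of_int (i\<^sup>2) + real_of_int (i * j) * (lam + mu) + real_of_int (j\<^sup>2) * (lam * mu)"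
    by (simp add: algebra_simps power2_eq_square)
  then show ?thesis by (simp add: lam_plus_mu lam_times_mu det_lin)
qed

text \<open>Write \<open>lam = \<theta> ^ n\<close> with the fundamental unit. The same coefficients
  give an integer matrix of determinant 1 or -1 whose \<open>n\<close>-th power is \<open>M\<close>,
  so primitivity forces \<open>n = 1\<close>.\<close>

lemma primitive_imp_lam_fundamental:
  assumes "primitive M" "(a, b) \<in> unit_pairs" "1 < a"
  shows "lam \<le> a"
proof -
  obtain \<theta> \<theta>' where t: "(\<theta>, \<theta>') \<in> unit_pairs" "\<theta> > 1"
    and all: "\<forall>a b. (a, b) \<in> unit_pairs \<longrightarrow> 1 < a \<longrightarrow> \<theta> \<le> a"
    by (rule fundamental_unit_exists)
  have min: "\<theta> \<le> a" if "(a, b) \<in> unit_pairs" "1 < a" for a b using all that by blast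
  obtain k :: int and s :: real where k: "s \<in> {1, -1}" "lam = s * \<theta> powi k"
    by (rule unit_pairs_generated[OF t min unit_pairs_lam])
  have p: "\<theta> powi k > 0" using t(2) by (simp add: zero_less_power_int)
  have "s = 1" using k p lam_gt_1 by auto
  then have lk: "lam = \<theta> powi k" using k by simp
  have "k > 0"
  proof (rule ccontr)
    assume "\<not> k > 0"
    then have "\<theta> powi k \<le> 1"
      using t(2) by (simp add: power_int_def power_le_one inverse_le_1_iff)
    then show False using lk lam_gt_1 by simp
  qed
  define n where "n = nat k"
  have n: "n \<ge> 1" "lam = \<theta> ^ n" using lk \<open>k > 0\<close> by (simp_all add: n_def power_int_def)
  obtain i j where ij: "\<theta> = real_of_int i + real_of_int j * lam" "\<theta>' = real_of_int i + real_of_int j * mu"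
    using t(1) unfolding unit_pairs_iff by (blast elim: conj_pairsE)
  have 1: "mat_power (lin M i j) n = M" using n(2) ij(1) by (simp add: mat_power_lin_eq_M_iff)
  have 2: "invertible (lin M i j)"
  proof -
    have "real_of_int (det (lin M i j)) = 1 \<or> real_of_int (det (lin M i j)) = -1"
      using t(1) unfolding norm_eq_det_lin[symmetric] unit_pairs_iff ij by blast
    then show ?thesis unfolding invertible_int_2 by (metis of_int_1 of_int_eq_iff of_int_minus)
  qed
  have "\<not> n \<ge> 2"
  proof
    assume "n \<ge> 2"
    then have "\<exists>K n. invertible K \<and> n \<ge> 2 \<and> M = mat_power K n"
      using 1[symmetric] 2 by (intro exI conjI)
    then show False using assms(1) unfolding primitive_def by contradiction
  qed
  then have "n = 1" using n(1) by simp
  then show ?thesis using n(2) min[OF assms(2,3)] by simp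
qed

text \<open>If \<open>K\<close> and \<open>M\<close> had equal determinants as well as equal
  discriminants, the number \<open>\<kappa>\<close> matching \<open>K\<close> would be
  \<open>lam\<close> or \<open>mu\<close> up to sign, which \<open>\<kappa> ^ n = lam\<close> with
  \<open>n \<ge> 2\<close> forbids. So \<open>det M = 1\<close> and \<open>det K = -1\<close>, the
  squared traces differ by 8, and the only such squares are 9 and 1.\<close>

lemma not_primitive_imp_golden:
  assumes "\<not> primitive M" and f: "\<bar>quad_form M x y\<bar> = 1"
  shows "trace M = 3" "det M = 1"
proof -
  obtain K n where K: "invertible K" "n \<ge> 2" "M = mat_power K n"
    using assms(1) unfolding primitive_def by blast
  obtain p q where pq: "mat_power K n = lin K p q" using mat_power_eq_lin by blast
  have M: "M = lin K p q" using K(3) pq by simp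
  have "\<bar>q\<bar> * \<bar>quad_form K x y\<bar> = 1" using f unfolding M quad_form_lin abs_mult .
  then have "\<bar>q\<bar> = 1" by (auto simp: zmult_eq_1_iff)
  then have "q = 1 \<or> q = -1" by auto
  then have q: "q * q = 1" "q = 1 \<or> q = -1" by auto
  have K': "K = lin M (- p * q) q" unfolding M using lin_lin_unit[OF q(1)] by simp
  define \<kappa> where "\<kappa> = real_of_int (- p * q) + real_of_int q * lam"
  have kn: "\<kappa> ^ n = lam"
    using K(3) unfolding \<kappa>_def mat_power_lin_eq_M_iff[symmetric] K'[symmetric] by simp
  have n1: "\<kappa> \<noteq> lam" "\<kappa> \<noteq> - lam"
  proof -
    have "lam ^ 1 < lam ^ n" using K(2) lam_gt_1 by (intro power_strict_increasing) auto
    moreover have "\<bar>\<kappa>\<bar> ^ n = lam" using kn lam_gt_1 by (simp add: power_abs[symmetric])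
    ultimately show "\<kappa> \<noteq> lam" "\<kappa> \<noteq> - lam" using lam_gt_1 by auto
  qed
  have n2: "\<bar>\<kappa>\<bar> \<noteq> \<bar>mu\<bar>"
  proof
    assume "\<bar>\<kappa>\<bar> = \<bar>mu\<bar>"
    then have "\<bar>\<kappa>\<bar> ^ n \<le> 1" using abs_mu_less_1 by (simp add: power_le_one)
    then show False using kn lam_gt_1 by (simp add: power_abs[symmetric])
  qed
  have tr: "trace M = 2 * p + q * trace K" unfolding M by (rule trace_lin)
  have dt: "det M = p\<^sup>2 + p * q * trace K + q\<^sup>2 * det K" unfolding M by (rule det_lin)
  have "(trace M)\<^sup>2 - 4 * det M = (q * q) * ((trace K)\<^sup>2 - 4 * det K)"
    unfolding tr dt by (simp add: power2_eq_square algebra_simps)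
  then have disc: "(trace M)\<^sup>2 - 4 * det M = (trace K)\<^sup>2 - 4 * det K" using q(1) by simp
  have dK: "det K = 1 \<or> det K = -1" using K(1) by (simp add: invertible_int_2)
  have "det M \<noteq> det K"
  proof
    assume "det M = det K"
    then have "(trace M)\<^sup>2 = (trace K)\<^sup>2" using disc by simp
    \<comment> \<open>The two signs give \<open>p = 0\<close>, where
      \<open>\<kappa> = q * lam\<close>, and \<open>p = trace M\<close>, where
      \<open>\<kappa> = - q * mu\<close>.\<close>
    then have "q * trace K = trace M \<or> q * trace K = - trace M"
      using q(2) by (auto simp: power2_eq_iff)
    then consider "p = 0" | "p = trace M" using tr by auto
    then show False
    proof cases
      case 1
      then show False using n1 q(2) by (auto simp: \<kappa>_def)
    next
      case 2
      have "real_of_int (trace M) = lam + mu" by (simp add: lam_plus_mu)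
      then have "\<kappa> = - real_of_int q * mu" using 2 by (simp add: \<kappa>_def algebra_simps)
      then show False using n2 q(2) by auto
    qed
  qed
  moreover have "det M = det K ^ n" using K(3) det_mat_power by metis
  ultimately have d: "det M = 1" "det K = -1" using dK det_M by auto
  then show "det M = 1" by simp
  define s where "s = \<bar>trace K\<bar>"
  have s: "trace M * trace M = s * s + 8" "s \<ge> 0"
    using disc d by (simp_all add: s_def power2_eq_square)
  have "trace M > s"
  proof (rule ccontr)
    assume "\<not> trace M > s"
    then have "trace M * trace M \<le> s * s" using trace_pos by (intro mult_mono) auto
    then show False using s by simp
  qed
  moreover have "trace M \<noteq> s + 1"
  proof
    assume "trace M = s + 1"
    then have "2 * s = 7" using s(1) by (simp add: algebra_simps)
    then show False by presburger
  qed
  moreover have "\<not> trace M \<ge> s + 3"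
  proof
    assume "trace M \<ge> s + 3"
    then have "(s + 3) * (s + 3) \<le> trace M * trace M" using s(2) by (intro mult_mono) auto
    then show False using s by (simp add: algebra_simps)
  qed
  ultimately have "trace M = s + 2" by simp
  moreover from this have "s = 1" using s(1) by (simp add: algebra_simps)
  ultimately show "trace M = 3" by simp
qed

text \<open>Cayley-Hamilton with trace 3 and determinant 1 gives \<open>(M - 1)^2 = M\<close>. The
  root \<open>K = M - 1\<close> satisfies \<open>K^2 = K + 1\<close>, the equation of the Fibonacci
  matrix.\<close>

lemma golden_imp_fib_square:
  assumes "trace M = 3" "det M = 1" and f: "\<bar>quad_form M x y\<bar> = 1"
  shows "\<exists>K. alg_conjugate K fib_matrix \<and> M = mat_power K 2"
proof (intro exI conjI)
  define K where "K = lin M (-1) 1"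
  show "M = mat_power (lin M (-1) 1) 2"
    unfolding mat_power_2 lin_mult using assms by (simp add: lin_0_1)
  have K: "K$1$1 = M$1$1 - 1" "K$1$2 = M$1$2" "K$2$1 = M$2$1" "K$2$2 = M$2$2 - 1"
    by (simp_all add: K_def)
  have d: "M$2$2 = 3 - M$1$1" using assms(1) by (simp add: trace_int_2)
  have 1: "M$1$2 * M$2$1 = M$1$1 * (3 - M$1$1) - 1" using assms(2) d unfolding det_int_2 by simp
  text \<open>A cyclic vector \<open>m\<close> gives the basis \<open>(K m, m)\<close>, in which \<open>K\<close> is the Fibonacci matrix.\<close>
  define m1 m2 where "m1 = - y" and "m2 = x"
  define P :: "int^2^2" where "P = vector [vector [K$1$1 * m1 + K$1$2 * m2, m1], vector [K$2$1 * m1 + K$2$2 * m2, m2]]"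
  have P: "P$1$1 = K$1$1 * m1 + K$1$2 * m2" "P$1$2 = m1" "P$2$1 = K$2$1 * m1 + K$2$2 * m2" "P$2$2 = m2"
    by (simp_all add: P_def vector_2)
  have F: "fib_matrix$1$1 = 1" "fib_matrix$1$2 = 1" "fib_matrix$2$1 = 1" "fib_matrix$2$2 = 0"
    by (simp_all add: fib_matrix_def vector_2)
  have "det P = quad_form M x y"
    unfolding det_int_2 P K quad_form_def m1_def m2_def by (simp add: algebra_simps power2_eq_square)
  then have detP: "det P * det P = 1" using f by (auto simp: abs_if split: if_splits)
  obtain B where B: "B ** P = mat 1" "P ** B = mat 1" using adjugate_inverse_int_2[OF detP] by blast
  have KP: "K ** P = P ** fib_matrix"
    unfolding mat2_eq_iff mult_int_2 P F K d
  proof (intro conjI)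
    show "(M$1$1 - 1) * ((M$1$1 - 1) * m1 + M$1$2 * m2) + M$1$2 * (M$2$1 * m1 + (3 - M$1$1 - 1) * m2)
        = ((M$1$1 - 1) * m1 + M$1$2 * m2) * 1 + m1 * 1"
      using 1 by algebra
    show "M$2$1 * ((M$1$1 - 1) * m1 + M$1$2 * m2) + (3 - M$1$1 - 1) * (M$2$1 * m1 + (3 - M$1$1 - 1) * m2)
        = (M$2$1 * m1 + (3 - M$1$1 - 1) * m2) * 1 + m2 * 1"
      using 1 by algebra
  qed simp_all
  \<comment> \<open>\<open>matrix_inv\<close> is defined by choice, so it is identified through
    uniqueness of two-sided inverses.\<close>
  have "matrix_inv B = P"
  proof -
    have "\<exists>A'. B ** A' = mat 1 \<and> A' ** B = mat 1" using B by blast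
    then have *: "B ** matrix_inv B = mat 1" "matrix_inv B ** B = mat 1"
      unfolding matrix_inv_def by (rule someI2_ex, blast)+
    have "matrix_inv B = (P ** B) ** matrix_inv B" using B by simp
    also have "\<dots> = P" using * by (simp add: matrix_mul_assoc[symmetric])
    finally show ?thesis .
  qed
  moreover have "B ** K ** P = fib_matrix"
  proof -
    have "B ** K ** P = B ** (P ** fib_matrix)" using KP by (simp add: matrix_mul_assoc[symmetric])
    then show ?thesis using B by (simp add: matrix_mul_assoc)
  qed
  moreover have "invertible B" unfolding invertible_def using B by blast
  ultimately have "invertible B \<and> B ** K ** matrix_inv B = fib_matrix" by (simp only:)
  then show "alg_conjugate (lin M (-1) 1) fib_matrix"
    unfolding alg_conjugate_def K_def by (rule exI)
qed

end

section \<open>The torus\<close>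

definition int_vec :: "real^2 \<Rightarrow> bool" where
  "int_vec x \<longleftrightarrow> (\<forall>i. x $ i \<in> \<int>)"

lemma to_torus_eq_int_vec: "to_torus x = to_torus y \<longleftrightarrow> int_vec (x - y)"
  unfolding to_torus_eq_iff int_vec_def by simp

lemma int_vec_add: "int_vec x \<Longrightarrow> int_vec y \<Longrightarrow> int_vec (x + y)"
  and int_vec_diff: "int_vec x \<Longrightarrow> int_vec y \<Longrightarrow> int_vec (x - y)"
  and int_vec_scale: "int_vec x \<Longrightarrow> int_vec (real_of_int k *\<^sub>R x)"
  by (simp_all add: int_vec_def)

lemma int_vec_small:
  assumes "int_vec x" "norm x < 1" shows "x = 0"
proof -
  have "x $ i = 0" for i
  proof -
    have "\<bar>x $ i\<bar> < 1" using component_le_norm_cart[of x i] assms(2) by linarith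
    moreover have "x $ i \<in> \<int>" using assms(1) by (simp add: int_vec_def)
    ultimately show ?thesis by (auto elim!: Ints_cases)
  qed
  then show ?thesis by (simp add: vec_eq_iff)
qed

lemma int_vec_obtain:
  assumes "int_vec x" obtains a b where "x $ 1 = real_of_int a" "x $ 2 = real_of_int b"
  using assms unfolding int_vec_def by (metis Ints_cases)

lemma tendsto_to_torus: "(f \<longlongrightarrow> l) F \<Longrightarrow> ((\<lambda>n. to_torus (f n)) \<longlongrightarrow> to_torus l) F"
proof (rule topological_tendstoI)
  fix S assume "(f \<longlongrightarrow> l) F" "open S" "to_torus l \<in> S"
  then have "\<forall>\<^sub>F n in F. f n \<in> to_torus -` S"
    by (intro topological_tendstoD) (auto simp: open_torus_def)
  then show "\<forall>\<^sub>F n in F. to_torus (f n) \<in> S" by simp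
qed

text \<open>The preimage of the image of a ball is the union of its integer translates, so that
  image is an open neighbourhood of zero in the quotient topology.\<close>

lemma to_torus_tendsto_0_lift:
  assumes "(\<lambda>n. to_torus (x n)) \<longlonglongrightarrow> to_torus 0" "e > 0"
  shows "\<forall>\<^sub>F n in sequentially. \<exists>z. int_vec z \<and> norm (x n - z) < e"
proof -
  have "to_torus -` (to_torus ` ball 0 e) = (\<Union>z\<in>{z. int_vec z}. ball z e)"
  proof (intro set_eqI iffI)
    fix y assume "y \<in> to_torus -` (to_torus ` ball 0 e)"
    then obtain b where b: "b \<in> ball 0 e" "to_torus y = to_torus b" by auto
    then have "int_vec (y - b)" by (simp add: to_torus_eq_int_vec)
    moreover have "y \<in> ball (y - b) e" using b(1) by (simp add: dist_norm)
    ultimately show "y \<in> (\<Union>z\<in>{z. int_vec z}. ball z e)" by blast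
  next
    fix y assume "y \<in> (\<Union>z\<in>{z. int_vec z}. ball z e)"
    then obtain z where z: "int_vec z" "norm (y - z) < e"
      by (auto simp: dist_norm norm_minus_commute)
    then have "to_torus y = to_torus (y - z)" by (simp add: to_torus_eq_int_vec)
    then show "y \<in> to_torus -` (to_torus ` ball 0 e)" using z(2) by auto
  qed
  then have "open (to_torus ` ball 0 e)" unfolding open_torus_def by (simp add: open_UN)
  then have "\<forall>\<^sub>F n in sequentially. to_torus (x n) \<in> to_torus ` ball 0 e"
    using assms by (intro topological_tendstoD[OF assms(1)]) auto
  then show ?thesis
  proof (rule eventually_mono)
    fix n assume "to_torus (x n) \<in> to_torus ` ball 0 e"
    then obtain b where "norm b < e" "to_torus (x n) = to_torus b" by auto
    then show "\<exists>z. int_vec z \<and> norm (x n - z) < e"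
      by (intro exI[of _ "x n - b"]) (simp add: to_torus_eq_int_vec)
  qed
qed

text \<open>A representative in the half-open square may lie on its boundary, but it is in the
  closure of the open box. Hence any neighbourhood of it meets the box in a nonempty open set, which
  is not null.\<close>

lemma open_torus_measure_pos:
  assumes "open U" "U \<noteq> {}"
  shows "emeasure torus_measure U > 0"
proof -
  define Q where "Q = {x :: real^2. \<forall>i. 0 \<le> x $ i \<and> x $ i < 1}"
  define V where "V = to_torus -` U"
  have V: "open V" using assms(1) by (simp add: V_def open_torus_def)
  have Qb: "Q \<in> sets borel"
  proof -
    have "Q = (\<Inter>i\<in>UNIV. ({x. 0 \<le> x $ i} \<inter> {x. x $ i < 1}))" by (auto simp: Q_def)
    moreover have "\<dots> \<in> sets borel"
      by (intro sets.finite_INT sets.Int borel_closed borel_open closed_Collect_le open_Collect_less continuous_intros) auto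
    ultimately show ?thesis by simp
  qed
  have meas: "to_torus \<in> measurable (restrict_space lborel Q) borel"
  proof -
    have "continuous_on UNIV to_torus"
      unfolding continuous_on_open_vimage[OF open_UNIV] by (simp add: open_torus_def)
    then have "to_torus \<in> borel_measurable borel" by (rule borel_measurable_continuous_onI)
    then have "to_torus \<in> measurable lborel borel" by simp
    then show ?thesis by (rule measurable_restrict_space1)
  qed
  have "emeasure torus_measure U = emeasure (restrict_space lborel Q) (V \<inter> space (restrict_space lborel Q))"
    unfolding torus_measure_def Q_def[symmetric] V_def using assms(1)
    by (intro emeasure_distr meas) simp
  also have "\<dots> = emeasure lborel (V \<inter> Q)"
    using Qb by (subst emeasure_restrict_space) (auto simp: space_restrict_space)
  finally have eq: "emeasure torus_measure U = emeasure lborel (V \<inter> Q)" .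
  obtain p where "p \<in> U" using assms(2) by blast
  define y where "y = rep_torus p"
  define x where "x = (\<chi> i. y $ i - real_of_int \<lfloor>y $ i\<rfloor>)"
  have "to_torus x = to_torus y" by (simp add: to_torus_eq_iff x_def)
  then have "x \<in> V" using \<open>p \<in> U\<close> by (simp add: V_def y_def)
  then obtain e where e: "e > 0" "ball x e \<subseteq> V" using V open_contains_ball by blast
  define B where "B = box 0 (1 :: real^2)"
  have BQ: "B \<subseteq> Q" by (auto simp: B_def Q_def mem_box_cart intro: less_imp_le)
  have "x \<in> cbox 0 1" by (auto simp: mem_box_cart x_def) linarith
  moreover have "B \<noteq> {}" by (simp add: B_def interval_ne_empty_cart)
  ultimately have "x \<in> closure B" unfolding B_def by (simp add: closure_box)
  then have "B \<inter> ball x e \<noteq> {}" using e(1)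
    by (metis centre_in_ball closure_iff_nhds_not_empty open_ball order_refl inf_commute)
  moreover have "open (B \<inter> ball x e)" by (simp add: B_def open_box open_Int)
  ultimately have "\<not> negligible (B \<inter> ball x e)" by (simp add: open_not_negligible)
  then have "emeasure lebesgue (B \<inter> ball x e) \<noteq> 0"
    using \<open>open (B \<inter> ball x e)\<close> by (auto simp: negligible_iff_emeasure0 lmeasurable_iff_integrable borel_open)
  then have "emeasure lborel (B \<inter> ball x e) \<noteq> 0"
    using \<open>open (B \<inter> ball x e)\<close> by (simp add: borel_open)
  moreover have "emeasure lborel (B \<inter> ball x e) \<le> emeasure lborel (V \<inter> Q)"
    using e(2) BQ V Qb by (intro emeasure_mono) auto
  ultimately show ?thesis using eq by (metis bot.extremum_uniqueI bot_ennreal zero_less_iff_neq_zero)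
qed

lemma space_torus_measure: "space torus_measure = UNIV"
  by (simp add: torus_measure_def)

lemma sets_torus_measure: "sets torus_measure = sets borel"
  by (simp add: torus_measure_def)

text \<open>This turns the failure of unique coding at every point into a contradiction with unique
  coding almost everywhere.\<close>

lemma torus_measure_not_AE_False: "\<not> (AE p in torus_measure. False)"
proof
  assume "AE p in torus_measure. False"
  then have "emeasure torus_measure (space torus_measure) = 0" by (simp add: AE_iff_null null_sets_def)
  then show False using open_torus_measure_pos[of UNIV] by (simp add: space_torus_measure)
qed

section \<open>Homoclinic points and codings\<close>

text \<open>This is the determinant of two columns. For a nonzero integer vector \<open>m\<close>,
  the modulus of \<open>cross2 m (act m)\<close> is the index of the lattice spanned by
  \<open>m\<close> and its image.\<close>

definition cross2 :: "real^2 \<Rightarrow> real^2 \<Rightarrow> real" where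
  "cross2 x y = x$1 * y$2 - x$2 * y$1"

lemma vec2_eq_iff: "(x :: 'a^2) = y \<longleftrightarrow> x$1 = y$1 \<and> x$2 = y$2"
  by (auto simp: vec_eq_iff forall_2)

lemma cross2_basis_expansion:
  assumes "cross2 t s \<noteq> 0"
  shows "p = (cross2 p s / cross2 t s) *\<^sub>R t + (cross2 t p / cross2 t s) *\<^sub>R s"
proof -
  have "cross2 p s * t$i + cross2 t p * s$i = cross2 t s * p$i" for i
    using exhaust_2[of i] by (auto simp: cross2_def algebra_simps)
  then have "p$i = cross2 p s / cross2 t s * t$i + cross2 t p / cross2 t s * s$i" for i
    using assms by (simp add: field_simps)
  then show ?thesis unfolding vec2_eq_iff by simp
qed

lemma cross2_lincomb:
  "cross2 (a *\<^sub>R t + b *\<^sub>R s) (c *\<^sub>R t + d *\<^sub>R s) = (a * d - b * c) * cross2 t s"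
  by (simp add: cross2_def algebra_simps)

lemma int_vec_cross2: "int_vec x \<Longrightarrow> int_vec y \<Longrightarrow> cross2 x y \<in> \<int>"
  by (simp add: int_vec_def cross2_def)

context hyperbolic_matrix begin

definition act :: "real^2 \<Rightarrow> real^2" where
  "act x = map_matrix real_of_int M *v x"

lemma act_component: "act x $ i = real_of_int (M$i$1) * x$1 + real_of_int (M$i$2) * x$2"
  by (simp add: act_def matrix_vector_mult_def map_matrix_def sum_2)

lemma linear_act: "linear act"
  unfolding act_def by (rule matrix_vector_mul_linear)

lemmas act_add = linear_add[OF linear_act]
  and act_diff = linear_diff[OF linear_act]
  and act_scale = linear_scale[OF linear_act]

lemma toral_map_to_torus: "toral_map M (to_torus x) = to_torus (act x)"
  unfolding act_def by (rule toral_map.abs_eq)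

lemma int_vec_act: "int_vec x \<Longrightarrow> int_vec (act x)"
  unfolding int_vec_def by (simp add: act_component)

lemma act_cayley_hamilton: "act (act x) = (lam + mu) *\<^sub>R act x - (lam * mu) *\<^sub>R x"
  unfolding lam_plus_mu lam_times_mu vec2_eq_iff
  by (simp add: act_component trace_int_2 det_int_2 algebra_simps)

text \<open>Cayley-Hamilton gives \<open>M (tr M - M) = det M\<close>, and \<open>det M\<close> is
  its own inverse. In this form it is visible that integer vectors are preserved.\<close>

definition act_inv :: "real^2 \<Rightarrow> real^2" where
  "act_inv x = real_of_int (det M) *\<^sub>R (real_of_int (trace M) *\<^sub>R x - act x)"

lemma det_square: "real_of_int (det M) * real_of_int (det M) = 1"
  using det_M by auto

lemma act_inv_act: "act_inv (act x) = x"
proof -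
  have "real_of_int (trace M) *\<^sub>R act x - act (act x) = real_of_int (det M) *\<^sub>R x"
    unfolding act_cayley_hamilton lam_plus_mu lam_times_mu by simp
  then show ?thesis unfolding act_inv_def by (simp add: det_square)
qed

lemma act_inv_diff: "act_inv (x - y) = act_inv x - act_inv y"
  by (simp add: act_inv_def act_diff algebra_simps)

lemma int_vec_act_inv: "int_vec x \<Longrightarrow> int_vec (act_inv x)"
  unfolding act_inv_def by (intro int_vec_scale int_vec_diff int_vec_act)

lemma act_inv_lam_eigen:
  assumes "act t = lam *\<^sub>R t" shows "act_inv t = (1 / lam) *\<^sub>R t"
proof -
  have "act_inv (act t) = lam *\<^sub>R act_inv t"
    using assms by (simp add: act_inv_def act_scale algebra_simps)
  then have "t = lam *\<^sub>R act_inv t" by (simp add: act_inv_act)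
  then have "(1 / lam) *\<^sub>R t = (1 / lam) *\<^sub>R (lam *\<^sub>R act_inv t)" by simp
  then show ?thesis using lam_gt_1 by simp
qed

lemma act_inv_mu_eigen:
  assumes "act s = mu *\<^sub>R s" shows "act (act_inv s) = mu *\<^sub>R act_inv s"
  using assms by (simp add: act_inv_def act_scale act_diff algebra_simps)

lemma inj_toral_map: "inj (toral_map M)"
proof (rule injI)
  fix p q assume eq: "toral_map M p = toral_map M q"
  obtain x y where xy: "p = to_torus x" "q = to_torus y" by (metis to_torus_rep)
  have "int_vec (act (x - y))"
    using eq unfolding xy toral_map_to_torus to_torus_eq_int_vec by (simp add: act_diff)
  then have "int_vec (x - y)" using int_vec_act_inv act_inv_act by metis
  then show "p = q" by (simp add: xy to_torus_eq_int_vec)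
qed

lemma toral_map_funpow_eigen:
  assumes "act t = lam *\<^sub>R t"
  shows "(toral_map M ^^ n) (to_torus t) = to_torus (lam ^ n *\<^sub>R t)"
  by (induction n) (simp_all add: toral_map_to_torus act_scale assms mult.commute)

lemma inv_toral_map_funpow_eigen:
  assumes "act t = lam *\<^sub>R t"
  shows "(inv (toral_map M) ^^ n) (to_torus t) = to_torus ((1 / lam) ^ n *\<^sub>R t)"
proof (induction n)
  case (Suc n)
  have "(1 / lam) ^ n *\<^sub>R t = act ((1 / lam) ^ Suc n *\<^sub>R t)"
    using lam_gt_1 by (simp add: act_scale assms)
  then have "to_torus ((1 / lam) ^ n *\<^sub>R t) = toral_map M (to_torus ((1 / lam) ^ Suc n *\<^sub>R t))"
    by (simp only: toral_map_to_torus)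
  then show ?case using Suc inj_toral_map by (simp add: inv_f_f)
qed simp

text \<open>This is the projection \<open>(M - mu) / (lam - mu)\<close> onto the
  \<open>lam\<close>-eigenline along the \<open>mu\<close>-eigenline.\<close>

definition unstable :: "real^2 \<Rightarrow> real^2" where
  "unstable m = (1 / (lam - mu)) *\<^sub>R (act m - mu *\<^sub>R m)"

definition stable :: "real^2 \<Rightarrow> real^2" where
  "stable m = m - unstable m"

lemma act_unstable: "act (unstable m) = lam *\<^sub>R unstable m"
proof -
  have "act (act m - mu *\<^sub>R m) = lam *\<^sub>R (act m - mu *\<^sub>R m)"
    by (simp add: act_diff act_scale act_cayley_hamilton algebra_simps)
  then show ?thesis by (simp add: unstable_def act_scale)
qed

lemma lam_minus_mu_scale: "(lam - mu) *\<^sub>R unstable m = act m - mu *\<^sub>R m"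
  using mu_less_lam by (simp add: unstable_def)

lemma act_stable: "act (stable m) = mu *\<^sub>R stable m"
proof -
  have "act (stable m) - mu *\<^sub>R stable m = (act m - mu *\<^sub>R m) - (lam - mu) *\<^sub>R unstable m"
    by (simp add: stable_def act_diff act_unstable algebra_simps)
  then show ?thesis by (simp add: lam_minus_mu_scale)
qed

lemma unstable_eqI:
  assumes "act t = lam *\<^sub>R t" "act (t - m) = mu *\<^sub>R (t - m)"
  shows "unstable m = t"
proof -
  have "act m = lam *\<^sub>R t - mu *\<^sub>R (t - m)" using assms by (simp add: act_diff algebra_simps)
  then have "act m - mu *\<^sub>R m = (lam - mu) *\<^sub>R t" by (simp add: algebra_simps)
  then show ?thesis using mu_less_lam by (simp add: unstable_def)
qed

text \<open>In eigenline coordinates the lattice spanned by \<open>m\<close> and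
  \<open>act m\<close> is the ring generated by \<open>lam\<close>, embedded through its two
  conjugates.\<close>

lemma conj_pair_lattice:
  assumes "a = real_of_int i + real_of_int j * lam" "b = real_of_int i + real_of_int j * mu"
  shows "a *\<^sub>R unstable m + b *\<^sub>R stable m = real_of_int i *\<^sub>R m + real_of_int j *\<^sub>R act m"
proof -
  have m: "unstable m + stable m = m" by (simp add: stable_def)
  have "lam *\<^sub>R unstable m + mu *\<^sub>R stable m = act (unstable m + stable m)"
    by (simp only: act_add act_stable act_unstable)
  then have am: "lam *\<^sub>R unstable m + mu *\<^sub>R stable m = act m" by (simp only: m)
  have "a *\<^sub>R unstable m + b *\<^sub>R stable m
      = real_of_int i *\<^sub>R (unstable m + stable m) + real_of_int j *\<^sub>R (lam *\<^sub>R unstable m + mu *\<^sub>R stable m)"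
    unfolding assms by (simp add: algebra_simps)
  then show ?thesis by (simp only: m am)
qed

lemma conj_pair_int_vec:
  assumes "(a, b) \<in> conj_pairs" "int_vec m"
  shows "int_vec (a *\<^sub>R unstable m + b *\<^sub>R stable m)"
proof -
  obtain i j where "a = real_of_int i + real_of_int j * lam" "b = real_of_int i + real_of_int j * mu"
    using assms(1) by (rule conj_pairsE)
  from conj_pair_lattice[OF this] show ?thesis
    using assms(2) by (simp add: int_vec_add int_vec_scale int_vec_act)
qed

text \<open>Forward iterates equal \<open>- mu ^ n\<close> times the stable component modulo
  integers, since the two components of \<open>M^n m\<close> add up to an integer vector. Backward
  iterates contract already in the plane.\<close>

lemma homoclinic_unstable:
  assumes "int_vec m" shows "homoclinic_coords M (unstable m)"
  unfolding homoclinic_coords_def homoclinic_def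
proof (intro conjI)
  show "map_matrix real_of_int M *v unstable m = lead_eigenvalue M *\<^sub>R unstable m"
    using act_unstable by (simp add: act_def lead_eigenvalue_eq)
  have "(\<lambda>n. to_torus (- (mu ^ n *\<^sub>R stable m))) \<longlonglongrightarrow> to_torus (- (0 *\<^sub>R stable m))"
    using abs_mu_less_1 by (intro tendsto_to_torus tendsto_intros LIMSEQ_power_zero) simp
  moreover have "to_torus (lam ^ n *\<^sub>R unstable m) = to_torus (- (mu ^ n *\<^sub>R stable m))" for n
    using conj_pair_int_vec[OF conj_pairs_power[OF conj_pairs_lam] assms]
    by (simp add: to_torus_eq_int_vec)
  ultimately show "(\<lambda>n. (toral_map M ^^ n) (to_torus (unstable m))) \<longlonglongrightarrow> to_torus 0"
    by (simp add: toral_map_funpow_eigen act_unstable)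
  have "(\<lambda>n. to_torus ((1 / lam) ^ n *\<^sub>R unstable m)) \<longlonglongrightarrow> to_torus (0 *\<^sub>R unstable m)"
    using lam_gt_1 by (intro tendsto_to_torus tendsto_intros LIMSEQ_power_zero) simp
  then show "(\<lambda>n. (inv (toral_map M) ^^ n) (to_torus (unstable m))) \<longlonglongrightarrow> to_torus 0"
    by (simp add: inv_toral_map_funpow_eigen act_unstable)
qed

text \<open>Applying \<open>M - mu\<close> to the orbit isolates its unstable part, which is
  multiplied by \<open>lam\<close> at each step; boundedness forces it to vanish.\<close>

lemma bounded_orbit_stable:
  assumes step: "\<And>n :: nat. e (Suc n) = act (e n)" and bd: "\<And>n. norm (e n) \<le> B"
  shows "act (e 0) = mu *\<^sub>R e 0"
proof -
  obtain C where C: "C > 0" "\<And>x. norm (act x) \<le> C * norm x"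
    using linear_bounded_pos[OF linear_act] by blast
  have B0: "B \<ge> 0" using bd[of 0] norm_ge_zero order_trans by blast
  define w where "w = (\<lambda>n. act (e n) - mu *\<^sub>R e n)"
  have "w (Suc n) = lam *\<^sub>R w n" for n
    unfolding w_def step by (simp add: act_cayley_hamilton algebra_simps)
  then have w: "w n = lam ^ n *\<^sub>R w 0" for n
    by (induction n) simp_all
  have wb: "norm (w n) \<le> C * B + B" for n
  proof -
    have "norm (w n) \<le> norm (act (e n)) + norm (mu *\<^sub>R e n)" unfolding w_def by (rule norm_triangle_ineq4)
    also have "norm (act (e n)) \<le> C * B" using C bd[of n] by (meson mult_left_mono order_trans less_imp_le)
    also have "norm (mu *\<^sub>R e n) \<le> 1 * B" unfolding norm_scaleR
      using abs_mu_less_1 bd[of n] by (intro mult_mono) auto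
    finally show ?thesis by simp
  qed
  have "w 0 = 0"
  proof (rule ccontr)
    assume "w 0 \<noteq> 0"
    then have p: "norm (w 0) > 0" by simp
    obtain n where "(C * B + B) / norm (w 0) < lam ^ n" using real_arch_pow[OF lam_gt_1] by blast
    then have "C * B + B < lam ^ n * norm (w 0)" using p by (simp add: field_simps)
    also have "\<dots> = norm (w n)" using lam_gt_1 by (subst w) simp
    finally show False using wb[of n] by simp
  qed
  then show ?thesis by (simp add: w_def)
qed

text \<open>Closeness to integer vectors is known only from some time on. The inverse matrix
  preserves integer vectors and the stable line, so the information can be carried back to time
  zero.\<close>

lemma stable_translate_pullback:
  assumes t: "act t = lam *\<^sub>R t" and z: "int_vec z" "act (lam ^ n *\<^sub>R t - z) = mu *\<^sub>R (lam ^ n *\<^sub>R t - z)"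
  shows "\<exists>m. int_vec m \<and> act (t - m) = mu *\<^sub>R (t - m)"
  using z
proof (induction n arbitrary: z)
  case 0
  then show ?case by auto
next
  case (Suc n)
  have "act_inv (lam ^ Suc n *\<^sub>R t) = lam ^ n *\<^sub>R t"
    using act_inv_lam_eigen[of "lam ^ Suc n *\<^sub>R t"] t lam_gt_1 by (simp add: act_scale)
  then have "act_inv (lam ^ Suc n *\<^sub>R t - z) = lam ^ n *\<^sub>R t - act_inv z" by (simp only: act_inv_diff)
  then have "act (lam ^ n *\<^sub>R t - act_inv z) = mu *\<^sub>R (lam ^ n *\<^sub>R t - act_inv z)"
    using act_inv_mu_eigen[OF Suc.prems(2)] by simp
  then show ?case using Suc.IH[OF int_vec_act_inv[OF Suc.prems(1)]] by blast
qed

text \<open>Let \<open>z k\<close> be integer vectors near late iterates. The residues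
  \<open>e k\<close> are so small that \<open>act (e k) - e (Suc k)\<close>, an integer vector,
  vanishes. They form a bounded orbit, hence lie on the stable line.\<close>

lemma homoclinic_imp_unstable:
  assumes "homoclinic_coords M t"
  obtains m where "int_vec m" "unstable m = t"
proof -
  have t: "act t = lam *\<^sub>R t" and lim: "(\<lambda>n. to_torus (lam ^ n *\<^sub>R t)) \<longlonglongrightarrow> to_torus 0"
  proof -
    show t: "act t = lam *\<^sub>R t"
      using assms by (simp add: homoclinic_coords_def act_def lead_eigenvalue_eq)
    show "(\<lambda>n. to_torus (lam ^ n *\<^sub>R t)) \<longlonglongrightarrow> to_torus 0"
      using assms toral_map_funpow_eigen[OF t] by (simp add: homoclinic_coords_def homoclinic_def)
  qed
  obtain C where C: "C > 0" "\<And>x. norm (act x) \<le> C * norm x"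
    using linear_bounded_pos[OF linear_act] by blast
  \<comment> \<open>The choice makes \<open>C * \<delta> + \<delta> = 1 / 2\<close>, below the
    length of a nonzero integer vector.\<close>
  define \<delta> where "\<delta> = 1 / (2 * (1 + C))"
  have d: "\<delta> > 0" "\<delta> * (1 + C) < 1" using C(1) by (simp_all add: \<delta>_def)
  obtain N where N: "\<And>n. n \<ge> N \<Longrightarrow> \<exists>z. int_vec z \<and> norm (lam ^ n *\<^sub>R t - z) < \<delta>"
    using to_torus_tendsto_0_lift[OF lim d(1)] unfolding eventually_sequentially by blast
  then have "\<forall>k. \<exists>z. int_vec z \<and> norm (lam ^ (N + k) *\<^sub>R t - z) < \<delta>"
    by simp
  from choice[OF this] obtain z
    where z: "\<And>k. int_vec (z k)" "\<And>k. norm (lam ^ (N + k) *\<^sub>R t - z k) < \<delta>" by blast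
  define e where "e = (\<lambda>k. lam ^ (N + k) *\<^sub>R t - z k)"
  have step: "e (Suc k) = act (e k)" for k
  proof -
    have eq: "act (e k) - e (Suc k) = z (Suc k) - act (z k)"
      by (simp add: e_def act_diff act_scale t mult.commute)
    have "norm (act (e k) - e (Suc k)) \<le> norm (act (e k)) + norm (e (Suc k))" by (rule norm_triangle_ineq4)
    also have "\<dots> \<le> C * \<delta> + \<delta>"
      using C(2)[of "e k"] z(2)[of k, THEN less_imp_le, THEN mult_left_mono, of C] z(2)[of "Suc k"] C(1)
      unfolding e_def by linarith
    also have "\<dots> < 1" using d(2) by (simp add: algebra_simps)
    finally have "norm (z (Suc k) - act (z k)) < 1" by (simp only: eq)
    then have "z (Suc k) - act (z k) = 0"
      by (intro int_vec_small int_vec_diff int_vec_act z)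
    then show ?thesis using eq by simp
  qed
  have "act (e 0) = mu *\<^sub>R e 0"
    using bounded_orbit_stable[of e \<delta>, OF step] z(2) by (simp add: e_def less_imp_le)
  then have "act (lam ^ N *\<^sub>R t - z 0) = mu *\<^sub>R (lam ^ N *\<^sub>R t - z 0)" by (simp add: e_def)
  from stable_translate_pullback[OF t z(1) this] show thesis
    using unstable_eqI[OF t] that by blast
qed

section \<open>Values of codings modulo the lattice\<close>

lemma two_sided_partial_sum:
  "(\<Sum>n = - int N..int N. real_of_int (\<epsilon> n) * lam powi (- n))
    = (\<Sum>n<Suc N. real_of_int (\<epsilon> (int n)) / lam ^ n) + (\<Sum>n<N. real_of_int (\<epsilon> (- 1 - int n)) * lam ^ (n + 1))"
proof (induction N)
  case 0
  then show ?case by simp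
next
  case (Suc N)
  have "{- int (Suc N)..int (Suc N)} = insert (- int (Suc N)) (insert (int (Suc N)) {- int N..int N})" by auto
  then have "(\<Sum>n = - int (Suc N)..int (Suc N). real_of_int (\<epsilon> n) * lam powi (- n))
      = real_of_int (\<epsilon> (- int (Suc N))) * lam powi int (Suc N) + (real_of_int (\<epsilon> (int (Suc N))) * lam powi (- int (Suc N))
        + (\<Sum>n = - int N..int N. real_of_int (\<epsilon> n) * lam powi (- n)))"
    by (simp add: add.commute)
  moreover have "lam powi (- int (Suc N)) = 1 / lam ^ Suc N"
    by (simp only: power_int_minus power_int_of_nat inverse_eq_divide)
  moreover have "lam powi int (Suc N) = lam ^ (N + 1)" by (simp only: power_int_of_nat) simp
  moreover have "- int (Suc N) = - 1 - int N" by simp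
  ultimately show ?case unfolding Suc.IH by (simp del: power_Suc)
qed

text \<open>In each partial sum, the part at negative positions is an element of the ring, and
  adding its conjugate times the stable component makes an integer vector. The divergent part can
  thus be exchanged for a convergent one without changing the point of the torus.\<close>

lemma coding_value:
  assumes m: "int_vec m" and c: "is_coding_by M (unstable m) \<phi>" and e: "\<epsilon> \<in> coding_space M"
    and a: "(\<lambda>n. real_of_int (\<epsilon> (int n)) / lam ^ n) sums a"
    and b: "(\<lambda>n. real_of_int (\<epsilon> (- 1 - int n)) * mu ^ (n + 1)) sums b"
  shows "\<phi> \<epsilon> = to_torus (a *\<^sub>R unstable m - b *\<^sub>R stable m)"
proof -
  let ?A = "\<lambda>N. \<Sum>n<N. real_of_int (\<epsilon> (int n)) / lam ^ n"
  let ?B = "\<lambda>N. \<Sum>n<N. real_of_int (\<epsilon> (- 1 - int n)) * mu ^ (n + 1)"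
  let ?C = "\<lambda>N. \<Sum>n<N. real_of_int (\<epsilon> (- 1 - int n)) * lam ^ (n + 1)"
  have "(\<lambda>N. to_torus (?A (Suc N) *\<^sub>R unstable m - ?B N *\<^sub>R stable m))
      \<longlonglongrightarrow> to_torus (a *\<^sub>R unstable m - b *\<^sub>R stable m)"
    using LIMSEQ_Suc[OF a[unfolded sums_def]] b[unfolded sums_def]
    by (intro tendsto_to_torus tendsto_intros)
  moreover have "to_torus (?A (Suc N) *\<^sub>R unstable m - ?B N *\<^sub>R stable m)
      = to_torus ((\<Sum>n = - int N..int N. real_of_int (\<epsilon> n) * lead_eigenvalue M powi (- n)) *\<^sub>R unstable m)" for N
  proof -
    have "int_vec (?C N *\<^sub>R unstable m + ?B N *\<^sub>R stable m)"
      by (intro conj_pair_int_vec m conj_pairs_digit_sum)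
    moreover have "?C N *\<^sub>R unstable m + ?B N *\<^sub>R stable m
      = (?A (Suc N) + ?C N) *\<^sub>R unstable m - (?A (Suc N) *\<^sub>R unstable m - ?B N *\<^sub>R stable m)"
      by (simp only: scaleR_add_left) simp
    ultimately have "to_torus ((?A (Suc N) + ?C N) *\<^sub>R unstable m) = to_torus (?A (Suc N) *\<^sub>R unstable m - ?B N *\<^sub>R stable m)"
      unfolding to_torus_eq_int_vec by (simp only:)
    then show ?thesis
      unfolding lead_eigenvalue_eq two_sided_partial_sum by (rule sym)
  qed
  ultimately have "(\<lambda>N. to_torus ((\<Sum>n = - int N..int N. real_of_int (\<epsilon> n) * lead_eigenvalue M powi (- n)) *\<^sub>R unstable m))
      \<longlonglongrightarrow> to_torus (a *\<^sub>R unstable m - b *\<^sub>R stable m)"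
    by (simp only:)
  moreover have "(\<lambda>N. to_torus ((\<Sum>n = - int N..int N. real_of_int (\<epsilon> n) * lead_eigenvalue M powi (- n)) *\<^sub>R unstable m))
      \<longlonglongrightarrow> \<phi> \<epsilon>"
    using c e unfolding is_coding_by_def by blast
  ultimately show ?thesis using LIMSEQ_unique by blast
qed

text \<open>In the basis of eigencomponents, \<open>m\<close> is \<open>(1, 1)\<close> and
  \<open>act m\<close> is \<open>(lam, mu)\<close>.\<close>

lemma cross2_act: "cross2 m (act m) = (mu - lam) * cross2 (unstable m) (stable m)"
proof -
  have "act m = lam *\<^sub>R unstable m + mu *\<^sub>R stable m"
    using conj_pair_lattice[of lam 0 1 mu m] by simp
  moreover have "m = 1 *\<^sub>R unstable m + 1 *\<^sub>R stable m" by (simp add: stable_def)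
  ultimately show ?thesis using cross2_lincomb[of 1 "unstable m" 1 "stable m" lam mu] by simp
qed

lemma quad_form_eq_cross2:
  assumes "m $ 1 = real_of_int x" "m $ 2 = real_of_int y"
  shows "real_of_int (quad_form M y (- x)) = - cross2 m (act m)"
  by (simp add: cross2_def act_component assms quad_form_def power2_eq_square algebra_simps)

text \<open>Completing the square, a nontrivial integer zero of the form would exhibit the
  discriminant as a square.\<close>

lemma cross2_act_nonzero:
  assumes "int_vec m" "m \<noteq> 0" shows "cross2 m (act m) \<noteq> 0"
proof
  assume z: "cross2 m (act m) = 0"
  obtain x y where xy: "m $ 1 = real_of_int x" "m $ 2 = real_of_int y"
    using assms(1) by (rule int_vec_obtain)
  have "quad_form M y (- x) = 0" using quad_form_eq_cross2[OF xy] z by simp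
  then have f: "M$1$2 * y * y + (M$1$1 - M$2$2) * x * y - M$2$1 * x * x = 0"
    by (simp add: quad_form_def power2_eq_square algebra_simps)
  define k where "k = 2 * M$2$1 * x - (M$1$1 - M$2$2) * y"
  have "k\<^sup>2 - ((trace M)\<^sup>2 - 4 * det M) * y\<^sup>2
      = - 4 * M$2$1 * (M$1$2 * y * y + (M$1$1 - M$2$2) * x * y - M$2$1 * x * x)"
    unfolding disc_eq k_def by (simp add: power2_eq_square algebra_simps)
  then have kD: "k\<^sup>2 = ((trace M)\<^sup>2 - 4 * det M) * y\<^sup>2" unfolding f by simp
  have "y = 0"
  proof (rule ccontr)
    assume y: "y \<noteq> 0"
    have "y\<^sup>2 dvd k\<^sup>2" unfolding kD by simp
    then have "y dvd k" by simp
    then obtain l where "k = y * l" by (elim dvdE)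
    then have "l\<^sup>2 = (trace M)\<^sup>2 - 4 * det M" using kD y by (simp add: power_mult_distrib)
    then show False using disc_not_square by blast
  qed
  moreover from this have "x = 0" using f off_diagonal_nonzero by simp
  ultimately show False using xy assms(2) by (simp add: vec2_eq_iff)
qed

text \<open>The sums \<open>a\<close> and \<open>b\<close> are returned with the code because they
  fix a point of the plane up to the lattice of \<open>m\<close>, which is finer information than
  the point of the torus.\<close>

lemma coding_surjective:
  assumes m: "int_vec m" "m \<noteq> 0" and c: "is_coding_by M (unstable m) \<phi>"
  obtains \<epsilon> i j a b where "\<epsilon> \<in> coding_space M" "\<phi> \<epsilon> = to_torus p"
    "(\<lambda>n. real_of_int (\<epsilon> (int n)) / lam ^ n) sums a"
    "(\<lambda>n. real_of_int (\<epsilon> (- 1 - int n)) * mu ^ (n + 1)) sums b"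
    "a *\<^sub>R unstable m - b *\<^sub>R stable m = p - (real_of_int i *\<^sub>R m + real_of_int j *\<^sub>R act m)"
proof -
  have "cross2 (unstable m) (stable m) \<noteq> 0"
    using cross2_act_nonzero[OF m] cross2_act by auto
  then obtain u v where p: "p = u *\<^sub>R unstable m + v *\<^sub>R stable m"
    using cross2_basis_expansion by blast
  obtain \<epsilon> i j where e: "\<epsilon> \<in> coding_space M"
    "(\<lambda>n. real_of_int (\<epsilon> (int n)) / lam ^ n) sums (u - (real_of_int i + real_of_int j * lam))"
    "(\<lambda>n. real_of_int (\<epsilon> (- 1 - int n)) * mu ^ (n + 1)) sums ((real_of_int i + real_of_int j * mu) - v)"
    by (rule compactum_coding_surjective)
  have eq: "(u - (real_of_int i + real_of_int j * lam)) *\<^sub>R unstable m - ((real_of_int i + real_of_int j * mu) - v) *\<^sub>R stable m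
      = p - (real_of_int i *\<^sub>R m + real_of_int j *\<^sub>R act m)"
    unfolding conj_pair_lattice[OF refl refl, symmetric] p by (simp add: algebra_simps)
  have "int_vec (p - (real_of_int i *\<^sub>R m + real_of_int j *\<^sub>R act m) - p)"
    using int_vec_scale[OF m(1), of "- i"] int_vec_scale[OF int_vec_act[OF m(1)], of j]
      int_vec_diff[of "- real_of_int i *\<^sub>R m" "real_of_int j *\<^sub>R act m"] by (simp add: algebra_simps)
  then have "\<phi> \<epsilon> = to_torus p"
    unfolding coding_value[OF m(1) c e] eq to_torus_eq_int_vec .
  then show thesis using that[OF e(1) _ e(2,3) eq] by blast
qed

lemma bijective_imp_cyclic:
  assumes "bijective_arithmetic_coding M \<phi>"
  obtains m where "int_vec m" "is_coding_by M (unstable m) \<phi>" "\<bar>cross2 m (act m)\<bar> = 1"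
proof -
  obtain t where t: "t \<noteq> 0" "homoclinic_coords M t" "is_coding_by M t \<phi>"
    using assms unfolding bijective_arithmetic_coding_def arithmetic_coding_def by blast
  obtain m where m: "int_vec m" "unstable m = t" using homoclinic_imp_unstable[OF t(2)] .
  have m0: "m \<noteq> 0" using t(1) m(2) linear_0[OF linear_act] by (auto simp: unstable_def)
  have c: "is_coding_by M (unstable m) \<phi>" using t(3) m(2) by simp
  have lattice: "\<exists>i j. w = real_of_int i *\<^sub>R m + real_of_int j *\<^sub>R act m" if w: "int_vec w" for w
  proof (rule ccontr)
    assume no: "\<nexists>i j. w = real_of_int i *\<^sub>R m + real_of_int j *\<^sub>R act m"
    have "\<not> (\<exists>!\<epsilon>. \<epsilon> \<in> coding_space M \<and> \<phi> \<epsilon> = p)" for p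
    proof
      assume ex1: "\<exists>!\<epsilon>. \<epsilon> \<in> coding_space M \<and> \<phi> \<epsilon> = p"
      define x where "x = rep_torus p"
      have px: "p = to_torus x" "p = to_torus (x + w)"
        using w to_torus_eq_int_vec[of "x + w" x] by (simp_all add: x_def)
      obtain \<epsilon> i j a b where 1: "\<epsilon> \<in> coding_space M" "\<phi> \<epsilon> = to_torus x"
        "(\<lambda>n. real_of_int (\<epsilon> (int n)) / lam ^ n) sums a"
        "(\<lambda>n. real_of_int (\<epsilon> (- 1 - int n)) * mu ^ (n + 1)) sums b"
        "a *\<^sub>R unstable m - b *\<^sub>R stable m = x - (real_of_int i *\<^sub>R m + real_of_int j *\<^sub>R act m)"
        by (rule coding_surjective[OF m(1) m0 c])
      obtain \<epsilon>' i' j' a' b' where 2: "\<epsilon>' \<in> coding_space M" "\<phi> \<epsilon>' = to_torus (x + w)"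
        "(\<lambda>n. real_of_int (\<epsilon>' (int n)) / lam ^ n) sums a'"
        "(\<lambda>n. real_of_int (\<epsilon>' (- 1 - int n)) * mu ^ (n + 1)) sums b'"
        "a' *\<^sub>R unstable m - b' *\<^sub>R stable m = x + w - (real_of_int i' *\<^sub>R m + real_of_int j' *\<^sub>R act m)"
        by (rule coding_surjective[OF m(1) m0 c])
      \<comment> \<open>The points \<open>x\<close> and \<open>x + w\<close> coincide on the torus,
        so unique coding gives them one code. Its sums then place both in the same class modulo the
        lattice of \<open>m\<close>, so \<open>w\<close> belongs to that lattice.\<close>
      have "\<epsilon>' = \<epsilon>" using ex1 1(1,2) 2(1,2) px by metis
      then have "a' = a" "b' = b" using 1(3,4) 2(3,4) sums_unique2 by blast+
      then have "x - (real_of_int i *\<^sub>R m + real_of_int j *\<^sub>R act m)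
          = x + w - (real_of_int i' *\<^sub>R m + real_of_int j' *\<^sub>R act m)" using 1(5) 2(5) by simp
      then have "w = real_of_int (i' - i) *\<^sub>R m + real_of_int (j' - j) *\<^sub>R act m"
        by (simp add: algebra_simps)
      then show False using no by blast
    qed
    then have "AE p in torus_measure. False"
      using assms unfolding bijective_arithmetic_coding_def by simp
    then show False using torus_measure_not_AE_False by simp
  qed
  \<comment> \<open>Both standard basis vectors lie in the lattice, so their determinant 1 is an
    integer multiple of \<open>cross2 m (act m)\<close>.\<close>
  have "int_vec (axis 1 1)" "int_vec (axis 2 1)" by (auto simp: int_vec_def axis_def)
  then obtain i j k l where ijkl: "axis 1 1 = real_of_int i *\<^sub>R m + real_of_int j *\<^sub>R act m"
    "axis 2 1 = real_of_int k *\<^sub>R m + real_of_int l *\<^sub>R act m"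
    using lattice by metis
  have "cross2 (axis 1 1) (axis 2 1) = 1" by (simp add: cross2_def axis_def)
  then have 1: "real_of_int (i * l - j * k) * cross2 m (act m) = 1"
    unfolding ijkl cross2_lincomb by simp
  have "cross2 m (act m) \<in> \<int>" by (intro int_vec_cross2 int_vec_act m)
  then obtain n where n: "cross2 m (act m) = real_of_int n" by (rule Ints_cases)
  then have "real_of_int ((i * l - j * k) * n) = real_of_int 1" using 1 by simp
  then have "(i * l - j * k) * n = 1" by (simp only: of_int_eq_iff)
  then have "\<bar>n\<bar> = 1" by (auto simp: zmult_eq_1_iff)
  then have "\<bar>cross2 m (act m)\<bar> = 1" using n by (metis of_int_abs of_int_1)
  then show thesis using that m(1) c by blast
qed

text \<open>By Cramer's rule with determinant 1 or -1, \<open>m\<close> is an integer combination of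
  \<open>m0\<close> and \<open>act m0\<close>, that is, \<open>m0\<close> times a ring element. The
  form scales by the norm of this element, so the norm is 1 or -1.\<close>

lemma cyclic_unstable_unit_multiple:
  assumes m0: "int_vec m0" "\<bar>cross2 m0 (act m0)\<bar> = 1" and m: "int_vec m" "\<bar>cross2 m (act m)\<bar> = 1"
  obtains a b where "(a, b) \<in> unit_pairs" "unstable m = a *\<^sub>R unstable m0"
proof -
  let ?d = "cross2 m0 (act m0)"
  have d: "?d = 1 \<or> ?d = -1" using m0(2) by linarith
  obtain i j where ij: "cross2 m (act m0) / ?d = real_of_int i" "cross2 m0 m / ?d = real_of_int j"
  proof -
    have "cross2 m (act m0) / ?d \<in> \<int>" "cross2 m0 m / ?d \<in> \<int>"
      using d int_vec_cross2[OF m(1) int_vec_act[OF m0(1)]] int_vec_cross2[OF m0(1) m(1)] by auto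
    then show thesis using that by (metis Ints_cases)
  qed
  have "?d \<noteq> 0" using d by auto
  from cross2_basis_expansion[OF this, of m]
  have mm: "m = real_of_int i *\<^sub>R m0 + real_of_int j *\<^sub>R act m0" by (simp only: ij)
  define a b where "a = real_of_int i + real_of_int j * lam" and "b = real_of_int i + real_of_int j * mu"
  have e: "m = a *\<^sub>R unstable m0 + b *\<^sub>R stable m0"
    unfolding mm a_def b_def conj_pair_lattice[OF refl refl] ..
  have u: "unstable m = a *\<^sub>R unstable m0"
    by (rule unstable_eqI) (simp_all add: e act_scale act_add act_unstable act_stable linear_neg[OF linear_act] mult.commute)
  then have s: "stable m = b *\<^sub>R stable m0" using e unfolding stable_def[of m] by (simp only: add_diff_cancel_left')
  have "cross2 m (act m) = (a * b) * ?d"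
    unfolding cross2_act u s by (simp add: cross2_def algebra_simps)
  then have "\<bar>a * b\<bar> = 1" using m(2) m0(2) by (simp add: abs_mult)
  then have "a * b = 1 \<or> a * b = -1" by linarith
  then have "(a, b) \<in> unit_pairs" unfolding unit_pairs_iff a_def b_def by (auto intro: conj_pairsI)
  then show thesis using that u by blast
qed

end

section \<open>Ergodicity\<close>

text \<open>For a level between two values, the open sublevel set is invariant; it and its
  complement both contain nonempty open sets, so neither is null.\<close>

lemma ergodic_invariant_continuous_const:
  fixes h :: "torus \<Rightarrow> real"
  assumes erg: "ergodic torus_measure T" and h: "continuous_on UNIV h" and inv: "\<And>p. h (T p) = h p"
  shows "h p = h q"
proof -
  have "\<not> h p < h q" for p q
  proof
    assume lt: "h p < h q"
    define c where "c = (h p + h q) / 2"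
    have c: "h p < c" "c < h q" using lt by (simp_all add: c_def)
    define A where "A = {x. h x < c}"
    have A: "open A" unfolding A_def using h by (intro open_Collect_less) (auto intro: continuous_intros)
    have A': "open {x. c < h x}" using h by (intro open_Collect_less) (auto intro: continuous_intros)
    have As: "A \<in> sets torus_measure" using A by (simp add: sets_torus_measure)
    have "T -` A \<inter> space torus_measure = A" by (auto simp: A_def inv space_torus_measure)
    then have "emeasure torus_measure A = 0 \<or> emeasure torus_measure (space torus_measure - A) = 0"
      using erg As unfolding ergodic_def by blast
    moreover have "emeasure torus_measure A > 0"
      using A c(1) by (intro open_torus_measure_pos) (auto simp: A_def)
    moreover have "0 < emeasure torus_measure {x. c < h x}"
      using A' c(2) by (intro open_torus_measure_pos) auto
    moreover have "emeasure torus_measure {x. c < h x} \<le> emeasure torus_measure (space torus_measure - A)"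
      using sets.compl_sets[OF As] by (intro emeasure_mono) (auto simp: A_def space_torus_measure)
    ultimately show False by (metis le_zero_eq less_irrefl)
  qed
  then show ?thesis by (meson linorder_neqE_linordered_idom)
qed

lemma ergodic_invariant_periodic_const:
  fixes g :: "real^2 \<Rightarrow> real" and M :: "int^2^2"
  assumes erg: "ergodic torus_measure (toral_map M)" and g: "continuous_on UNIV g"
    and per: "\<And>x z. int_vec z \<Longrightarrow> g (x + z) = g x"
    and inv: "\<And>x. g (map_matrix real_of_int M *v x) = g x"
  shows "g x = g y"
proof -
  define h where "h = (\<lambda>p. g (rep_torus p))"
  have h: "h (to_torus x) = g x" for x
  proof -
    have "int_vec (rep_torus (to_torus x) - x)" unfolding to_torus_eq_int_vec[symmetric] by simp
    from per[OF this, of x] show ?thesis by (simp add: h_def)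
  qed
  have "open (h -` S)" if "open S" for S
  proof -
    have "to_torus -` (h -` S) = g -` S" by (auto simp: h)
    moreover have "open (g -` S)" using g that by (simp add: continuous_on_open_vimage)
    ultimately show ?thesis by (simp add: open_torus_def)
  qed
  then have "continuous_on UNIV h" by (simp add: continuous_on_open_vimage)
  moreover have "h (toral_map M p) = h p" for p
  proof -
    have "toral_map M (to_torus (rep_torus p)) = to_torus (map_matrix real_of_int M *v rep_torus p)"
      by (rule toral_map.abs_eq)
    then show ?thesis using h inv by (metis to_torus_rep)
  qed
  ultimately have "h (to_torus x) = h (to_torus y)"
    by (rule ergodic_invariant_continuous_const[OF erg])
  then show ?thesis by (simp add: h)
qed

lemma cos_2pi_add_int: "z \<in> \<int> \<Longrightarrow> cos (2 * pi * (x + z)) = cos (2 * pi * x)"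
proof (elim Ints_cases)
  fix k assume z: "z = real_of_int k"
  have "2 * pi * (x + z) = 2 * pi * x + 2 * pi * real_of_int k"
    by (simp add: z distrib_left)
  then show ?thesis by (simp add: cos_add)
qed

text \<open>Here \<open>M^2 = M - 1\<close>, so \<open>M^3 = -1\<close>. Summing the even function
  \<open>c\<close> over \<open>x\<close>, \<open>M x\<close> and \<open>M^2 x\<close> gives an
  invariant function with value 6 at the origin and at most 4 at \<open>(1/2, 0)\<close>.\<close>

lemma ergodic_trace_ne_1:
  fixes M :: "int^2^2"
  assumes erg: "ergodic torus_measure (toral_map M)" and d: "det M = 1"
  shows "trace M \<noteq> 1"
proof
  assume t: "trace M = 1"
  let ?A = "\<lambda>x. map_matrix real_of_int M *v x"
  have comp: "?A x $ i = real_of_int (M$i$1) * x$1 + real_of_int (M$i$2) * x$2" for x i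
    by (simp add: matrix_vector_mult_def map_matrix_def sum_2)
  have iv: "int_vec (?A z)" if "int_vec z" for z
    using that unfolding int_vec_def by (simp add: comp)
  have m: "M$2$2 = 1 - M$1$1" using t by (simp add: trace_int_2)
  have bc: "M$1$2 * M$2$1 = M$1$1 * (1 - M$1$1) - 1" using d m unfolding det_int_2 by simp
  have AA: "?A (?A x) = ?A x - x" for x
  proof -
    have r: "real_of_int (M$2$2) = 1 - real_of_int (M$1$1)"
      "real_of_int (M$1$2) * real_of_int (M$2$1) = real_of_int (M$1$1) * (1 - real_of_int (M$1$1)) - 1"
      using m arg_cong[OF bc, of real_of_int] by simp_all
    show ?thesis unfolding vec2_eq_iff vector_minus_component comp
      using r by (intro conjI; algebra)
  qed
  define c where "c = (\<lambda>x :: real^2. cos (2 * pi * x$1) + cos (2 * pi * x$2))"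
  define g where "g = (\<lambda>x. c x + c (?A x) + c (?A x - x))"
  have cp: "c (x + z) = c x" if "int_vec z" for x z
    using that by (simp add: c_def int_vec_def cos_2pi_add_int)
  have "g x = g 0" for x
  proof (rule ergodic_invariant_periodic_const[OF erg])
    show "continuous_on UNIV g"
      unfolding g_def c_def by (simp add: comp) (intro continuous_intros)
    show "g (x + z) = g x" if z: "int_vec z" for x z
    proof -
      have "?A (x + z) - (x + z) = (?A x - x) + (?A z - z)" by (simp add: matrix_vector_right_distrib)
      then have "c (?A (x + z) - (x + z)) = c (?A x - x)"
        using cp[OF int_vec_diff[OF iv[OF z] z]] by (simp only:)
      moreover have "c (?A (x + z)) = c (?A x)"
        using cp[OF iv[OF z]] by (simp add: matrix_vector_right_distrib)
      ultimately show ?thesis unfolding g_def using cp[OF z] by simp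
    qed
    show "g (?A x) = g x" for x
    proof -
      have "c (?A (?A x) - ?A x) = c x" unfolding AA by (simp add: c_def)
      then show ?thesis unfolding g_def AA by simp
    qed
  qed
  from this[of "vector [1/2, 0]"] have "g (vector [1/2, 0]) = 6"
    by (simp add: g_def c_def)
  moreover have "c (vector [1/2, 0]) = 0" by (simp add: c_def vector_2)
  moreover have "c x \<le> 2" for x
    unfolding c_def using cos_le_one[of "2 * pi * x$1"] cos_le_one[of "2 * pi * x$2"] by linarith
  ultimately show False unfolding g_def
    by (smt (verit))
qed

text \<open>The eigenvalue 1 has an integer left eigenvector \<open>w\<close>, and the real part of
  the corresponding character is invariant. It takes the value -1 half a period away from the
  origin.\<close>

lemma ergodic_trace_ne_2:
  fixes M :: "int^2^2"
  assumes erg: "ergodic torus_measure (toral_map M)" and d: "det M = 1"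
  shows "trace M \<noteq> 2"
proof
  assume t: "trace M = 2"
  have m: "M$2$2 = 2 - M$1$1" using t by (simp add: trace_int_2)
  have bc: "M$1$2 * M$2$1 = M$1$1 * (2 - M$1$1) - 1" using d m unfolding det_int_2 by simp
  obtain w1 w2 :: int where w: "w1 \<noteq> 0 \<or> w2 \<noteq> 0"
    "w1 * M$1$1 + w2 * M$2$1 = w1" "w1 * M$1$2 + w2 * M$2$2 = w2"
  \<comment> \<open>The general witness \<open>(M$2$1, 1 - M$1$1)\<close> annihilates the first
    column of \<open>M - 1\<close>; the second follows since \<open>M - 1\<close> is singular. When
    this witness is zero, \<open>(0, 1)\<close> serves instead.\<close>
  proof (cases "M$2$1 = 0 \<and> M$1$1 = 1")
    case True
    then show ?thesis using that[of 0 1] m by simp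
  next
    case False
    then show ?thesis using that[of "M$2$1" "1 - M$1$1"] m bc by (auto simp: algebra_simps)
  qed
  define g where "g = (\<lambda>x :: real^2. cos (2 * pi * (real_of_int w1 * x$1 + real_of_int w2 * x$2)))"
  have gc: "g x = g 0" for x
  proof (rule ergodic_invariant_periodic_const[OF erg])
    show "continuous_on UNIV g" unfolding g_def by (intro continuous_intros)
    show "g (x + z) = g x" if z: "int_vec z" for x z
    proof -
      have "real_of_int w1 * z$1 + real_of_int w2 * z$2 \<in> \<int>" using z by (simp add: int_vec_def)
      from cos_2pi_add_int[OF this, of "real_of_int w1 * x$1 + real_of_int w2 * x$2"]
      show ?thesis unfolding g_def by (simp add: algebra_simps)
    qed
    show "g (map_matrix real_of_int M *v x) = g x" for x
    proof -
      have comp: "(map_matrix real_of_int M *v x) $ i = real_of_int (M$i$1) * x$1 + real_of_int (M$i$2) * x$2" for i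
        by (simp add: matrix_vector_mult_def map_matrix_def sum_2)
      have "real_of_int w1 * (map_matrix real_of_int M *v x) $ 1 + real_of_int w2 * (map_matrix real_of_int M *v x) $ 2
        = real_of_int (w1 * M$1$1 + w2 * M$2$1) * x$1 + real_of_int (w1 * M$1$2 + w2 * M$2$2) * x$2"
        unfolding comp by (simp add: algebra_simps)
      then show ?thesis unfolding g_def w by simp
    qed
  qed
  show False
  proof (cases "w1 = 0")
    case True
    then show False using gc[of "vector [0, 1 / (2 * real_of_int w2)]"] w(1) by (simp add: g_def vector_2)
  next
    case False
    then show False using gc[of "vector [1 / (2 * real_of_int w1), 0]"] by (simp add: g_def vector_2)
  qed
qed

lemma ergodic_imp_hyperbolic:
  fixes M :: "int^2^2"
  assumes "invertible M" "ergodic torus_measure (toral_map M)" "trace M > 0"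
  shows "hyperbolic_matrix M"
proof
  show "det M = 1 \<or> det M = -1" using assms(1) by (simp add: invertible_int_2)
  show "trace M > 0" by fact
  show "trace M \<ge> 3" if "det M = 1"
    using ergodic_trace_ne_1[OF assms(2) that] ergodic_trace_ne_2[OF assms(2) that] assms(3) by linarith
qed

section \<open>Bijective codings as unit multiples of one base point\<close>

context hyperbolic_matrix begin

lemma bijective_imp_quad_form_unit:
  assumes "bijective_arithmetic_coding M \<phi>"
  obtains x y where "\<bar>quad_form M x y\<bar> = 1"
proof -
  obtain m where m: "int_vec m" "\<bar>cross2 m (act m)\<bar> = 1" using bijective_imp_cyclic[OF assms] .
  obtain x y where xy: "m $ 1 = real_of_int x" "m $ 2 = real_of_int y" using m(1) by (rule int_vec_obtain)
  have "real_of_int \<bar>quad_form M y (- x)\<bar> = 1" using quad_form_eq_cross2[OF xy] m(2) by simp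
  then have "\<bar>quad_form M y (- x)\<bar> = 1" by (simp only: of_int_eq_1_iff)
  then show thesis by (rule that)
qed

text \<open>A solution \<open>(x, y)\<close> of the form gives the cyclic vector
  \<open>(- y, x)\<close>, whose unstable component serves as base point. The parameter
  \<open>\<theta>\<close> allows both \<open>lam\<close> and \<open>sqrt lam\<close> as generator of
  the units.\<close>

lemma bijective_codings_unit_multiples:
  assumes f: "\<bar>quad_form M x y\<bar> = 1" and g: "(\<theta>, \<theta>') \<in> unit_pairs" "\<theta> > 1"
    and min: "\<And>a b. (a, b) \<in> unit_pairs \<Longrightarrow> 1 < a \<Longrightarrow> \<theta> \<le> a"
  shows "\<exists>t. homoclinic_coords M t \<and>
    (\<forall>\<phi>. bijective_arithmetic_coding M \<phi> \<longrightarrow>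
      (\<exists>k :: int. \<exists>s \<in> {1, -1 :: real}. is_coding_by M ((s * \<theta> powi k) *\<^sub>R t) \<phi>))"
proof -
  define m0 :: "real^2" where "m0 = vector [real_of_int (- y), real_of_int x]"
  have c: "m0 $ 1 = real_of_int (- y)" "m0 $ 2 = real_of_int x" by (simp_all add: m0_def vector_2)
  have i0: "int_vec m0" by (simp add: int_vec_def forall_2 c)
  have "real_of_int \<bar>quad_form M x y\<bar> = \<bar>cross2 m0 (act m0)\<bar>" using quad_form_eq_cross2[OF c] by simp
  then have f0: "\<bar>cross2 m0 (act m0)\<bar> = 1" using f by simp
  have "\<exists>k :: int. \<exists>s \<in> {1, -1 :: real}. is_coding_by M ((s * \<theta> powi k) *\<^sub>R unstable m0) \<phi>"
    if bij: "bijective_arithmetic_coding M \<phi>" for \<phi>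
  proof -
    obtain m where m: "int_vec m" "is_coding_by M (unstable m) \<phi>" "\<bar>cross2 m (act m)\<bar> = 1"
      by (rule bijective_imp_cyclic[OF bij])
  obtain a b where ab: "(a, b) \<in> unit_pairs" "unstable m = a *\<^sub>R unstable m0"
    by (rule cyclic_unstable_unit_multiple[OF i0 f0 m(1,3)])
    obtain k :: int and s :: real where sk: "s \<in> {1, -1}" "a = s * \<theta> powi k"
      by (rule unit_pairs_generated[OF g min ab(1)])
    have "is_coding_by M ((s * \<theta> powi k) *\<^sub>R unstable m0) \<phi>" using m(2) by (simp only: ab(2) sk(2))
    then show ?thesis using sk(1) by blast
  qed
  then show ?thesis using homoclinic_unstable[OF i0] by blast
qed

end

theorem theorem2p6:
  fixes M :: "int^2^2"
  assumes "invertible M"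
    and "ergodic torus_measure (toral_map M)"
    and "trace M > 0"
  shows
    "((\<exists>\<phi>. bijective_arithmetic_coding M \<phi>) \<longrightarrow>
        primitive M \<or> (\<exists>K. alg_conjugate K fib_matrix \<and> M = mat_power K 2))
     \<and>
     ((\<exists>x y :: int. quad_form M x y = 1 \<or> quad_form M x y = -1) \<longrightarrow>
        (primitive M \<longrightarrow>
           (\<exists>t. homoclinic_coords M t \<and>
              (\<forall>\<phi>. bijective_arithmetic_coding M \<phi> \<longrightarrow>
                 (\<exists>k :: int. \<exists>s \<in> {1, -1 :: real}.
                    is_coding_by M ((s * lead_eigenvalue M powi k) *\<^sub>R t) \<phi>))))
        \<and>
        (\<not> primitive M \<longrightarrow>
           lead_eigenvalue M = (3 + sqrt 5) / 2 \<and>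
           sqrt (lead_eigenvalue M) = (1 + sqrt 5) / 2 \<and>
           (\<exists>t. homoclinic_coords M t \<and>
              (\<forall>\<phi>. bijective_arithmetic_coding M \<phi> \<longrightarrow>
                 (\<exists>k :: int. \<exists>s \<in> {1, -1 :: real}.
                    is_coding_by M ((s * sqrt (lead_eigenvalue M) powi k) *\<^sub>R t) \<phi>)))))"
proof -
  interpret hyperbolic_matrix M by (rule ergodic_imp_hyperbolic[OF assms])
  show ?thesis
  proof (intro conjI impI)
    assume "\<exists>\<phi>. bijective_arithmetic_coding M \<phi>"
    then obtain x y where f: "\<bar>quad_form M x y\<bar> = 1" using bijective_imp_quad_form_unit by blast
    show "primitive M \<or> (\<exists>K. alg_conjugate K fib_matrix \<and> M = mat_power K 2)"
      using golden_imp_fib_square[OF not_primitive_imp_golden[OF _ f] f] by blast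
  next
    assume "\<exists>x y. quad_form M x y = 1 \<or> quad_form M x y = -1" and p: "primitive M"
    then obtain x y where "quad_form M x y = 1 \<or> quad_form M x y = -1" by blast
    then have f: "\<bar>quad_form M x y\<bar> = 1" by auto
    show "\<exists>t. homoclinic_coords M t \<and> (\<forall>\<phi>. bijective_arithmetic_coding M \<phi> \<longrightarrow>
        (\<exists>k :: int. \<exists>s \<in> {1, -1 :: real}. is_coding_by M ((s * lead_eigenvalue M powi k) *\<^sub>R t) \<phi>))"
      unfolding lead_eigenvalue_eq
      by (rule bijective_codings_unit_multiples[OF f unit_pairs_lam lam_gt_1 primitive_imp_lam_fundamental[OF p]])
  next
    assume "\<exists>x y. quad_form M x y = 1 \<or> quad_form M x y = -1" and p: "\<not> primitive M"
    then obtain x y where "quad_form M x y = 1 \<or> quad_form M x y = -1" by blast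
    then have f: "\<bar>quad_form M x y\<bar> = 1" by auto
    note gold = golden_unit[OF not_primitive_imp_golden[OF p f]]
    show "lead_eigenvalue M = (3 + sqrt 5) / 2" "sqrt (lead_eigenvalue M) = (1 + sqrt 5) / 2"
      unfolding lead_eigenvalue_eq by (rule gold)+
    obtain g' where g': "(sqrt lam, g') \<in> unit_pairs" using gold(3) by blast
    have "sqrt lam > 1" using lam_gt_1 by simp
    from bijective_codings_unit_multiples[OF f g' this gold(4)]
    show "\<exists>t. homoclinic_coords M t \<and> (\<forall>\<phi>. bijective_arithmetic_coding M \<phi> \<longrightarrow>
        (\<exists>k :: int. \<exists>s \<in> {1, -1 :: real}. is_coding_by M ((s * sqrt (lead_eigenvalue M) powi k) *\<^sub>R t) \<phi>))"
      unfolding lead_eigenvalue_eq .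
  qed
qed

end
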